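(* There is an absolute constant $c>0$ such that for every odd $n$ and every positive integer $t$ with $t\leq c\, n\sqrt{\log n}$, the value of the $t$-fold symmetric repetition of the odd cycle game satisfies ${\sf val}(C_n^{\otimes_{\sf sym} t})\leq 1-c\,\frac{t}{n\sqrt{\log t}}$.
   Context: The odd cycle game $C_n$ ($n$ odd) is the following two-prover one-round game. The verifier picks a vertex $u$ of the $n$-cycle $\mathbb{Z}_n$ uniformly at random; with probability $1/2$ sets $v=u$, and otherwise sets $v$ to be one of the two neighbours of $u$, each with equal probability. It sends $u$ to the first prover and $v$ to the second, receives bits $b_1,b_2$, and accepts iff $b_1=b_2$ when $u=v$ and $b_1\neq b_2$ when $u\neq v$. The $t$-fold symmetric repetition $C_n^{\otimes_{\sf sym} t}$: the verifier samples $t$ independent challenges $(u_1,v_1),\dots,(u_t,v_t)$ of $C_n$ and sends them as unordered tuples $\{u_1,\dots,u_t\}$ and $\{v_1,\dots,v_t\}$; each prover answers a bit for each element it received, and the verifier accepts iff every constraint $(u_i,v_i)$ is satisfied by the corresponding answers. Equivalently, a prover strategy is a function $A\colon\mathbb{Z}_n^t\to\{0,1\}^t$ with $A(\pi(x))=\pi(A(x))$ for all permutations $\pi$ of $[t]$. The value ${\sf val}$ is the maximum over prover strategies of the acceptance probability. *)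

theory Defs
  imports "HOL-Probability.Probability" "HOL-Combinatorics.Permutations"
begin

(* Z_n is represented by {..<n}; u + n - 1 is the predecessor without truncated subtraction. *)
definition cycle_neighbours :: "nat \<Rightarrow> nat \<Rightarrow> nat set" where
  "cycle_neighbours n u = {(u + 1) mod n, (u + n - 1) mod n}"

definition cycle_challenge :: "nat \<Rightarrow> (nat \<times> nat) pmf" where
  "cycle_challenge n = do {
     u \<leftarrow> pmf_of_set {..<n};
     same \<leftarrow> bernoulli_pmf (1 / 2);
     v \<leftarrow> (if same then return_pmf u else pmf_of_set (cycle_neighbours n u));
     return_pmf (u, v)
   }"

definition cycle_accepts :: "nat \<times> nat \<Rightarrow> bool \<Rightarrow> bool \<Rightarrow> bool" where
  "cycle_accepts c b1 b2 = (if fst c = snd c then b1 = b2 else b1 \<noteq> b2)"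

definition tuples :: "nat \<Rightarrow> 'a set \<Rightarrow> 'a list set" where
  "tuples t S = {xs. set xs \<subseteq> S \<and> length xs = t}"

(* Receiving an unordered tuple is encoded by equivariance under permutations of coordinates.
   Strategies are extensional, so that there are finitely many of them. *)
definition sym_strategies :: "nat \<Rightarrow> nat \<Rightarrow> (nat list \<Rightarrow> bool list) set" where
  "sym_strategies n t =
     {A \<in> tuples t {..<n} \<rightarrow>\<^sub>E tuples t UNIV.
        \<forall>x \<in> tuples t {..<n}. \<forall>\<pi>. \<pi> permutes {..<t} \<longrightarrow>
          A (permute_list \<pi> x) = permute_list \<pi> (A x)}"

definition sym_win_prob ::
  "nat \<Rightarrow> nat \<Rightarrow> (nat list \<Rightarrow> bool list) \<Rightarrow> (nat list \<Rightarrow> bool list) \<Rightarrow> real" where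
  "sym_win_prob n t A B =
     measure_pmf.prob (replicate_pmf t (cycle_challenge n))
       {cs. \<forall>i<t. cycle_accepts (cs ! i) (A (map fst cs) ! i) (B (map snd cs) ! i)}"

definition sym_val :: "nat \<Rightarrow> nat \<Rightarrow> real" where
  "sym_val n t =
     Max {sym_win_prob n t A B | A B. A \<in> sym_strategies n t \<and> B \<in> sym_strategies n t}"

(* The maximum in sym_val ranges over a finite nonempty set. *)

lemma finite_tuples: "finite S \<Longrightarrow> finite (tuples t S)"
  unfolding tuples_def by (rule finite_lists_length_eq)

lemma finite_sym_strategies: "finite (sym_strategies n t)"
  by (rule finite_subset[of _ "tuples t {..<n} \<rightarrow>\<^sub>E (tuples t UNIV :: bool list set)"])
     (auto simp: sym_strategies_def intro!: finite_PiE finite_tuples)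

lemma sym_strategies_nonempty: "sym_strategies n t \<noteq> {}"
proof -
  have "permute_list \<pi> (replicate t False) = replicate t False"
    if "\<pi> permutes {..<t}" for \<pi>
    using that permutes_in_image[OF that]
    by (intro nth_equalityI) (auto simp: permute_list_nth)
  moreover have "permute_list \<pi> x \<in> tuples t {..<n}"
    if "\<pi> permutes {..<t}" "x \<in> tuples t {..<n}" for \<pi> x
    using that by (auto simp: tuples_def)
  ultimately have "restrict (\<lambda>_. replicate t False) (tuples t {..<n}) \<in> sym_strategies n t"
    by (auto simp: sym_strategies_def) (auto simp: tuples_def)
  then show ?thesis by blast
qed

lemma finite_sym_win_probs:
  "finite {sym_win_prob n t A B | A B. A \<in> sym_strategies n t \<and> B \<in> sym_strategies n t}"
  by (rule finite_image_set2) (simp_all add: finite_sym_strategies)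

end

(* Since n is odd, a position in Z_n together with a bit is a position in Z_2n, so a strategy lifts
   configurations of t points on the n-cycle to its double cover, equivariantly under permutations
   of the points; winning a round means that the lift moves along with the points.

   A union bound along straight paths shows that the lift survives jumps of length T up to
   probability T p, where p is the losing probability. By Cauchy-Schwarz, K independent jumps are
   survived with probability at least (1 - T p)^K, much more than a union bound would give when
   T p is constant and K is of order ln t.

   Conversely, after K jumps the points have spread out over cells of length n ln t / t holding about
   ln t points each. Going around an odd cycle flips the lift, so in some pair of adjacent cells many
   points carry either label. Exchanging the new positions of two points with different labels
   destroys consistency, so the lift survives only with probability t^(-c). Comparing the bounds for
   T of order n sqrt(ln t) / t gives the theorem. *)
theory Submission
  imports Defs
begin

section \<open>Finitely supported expectations\<close>

text \<open>The square root is a diffusion effect. A straight path as long as an arc of adjacent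
  cells takes about \<open>n ln t / t\<close> steps, and a union bound over them would give only a
  loss of order \<open>t / (n ln t)\<close>. Independent symmetric jumps spread like a random walk:
  \<open>K\<close> of length \<open>T\<close> reach distance \<open>T sqrt K\<close>, so
  \<open>T\<close> may be smaller by the factor \<open>sqrt K\<close>. The price is that survival is
  only bounded below by a small negative power of \<open>t\<close>, so the exchange argument must
  gain exponentially in the number of points per cell.

  Exchanging needs the law of the displacement to be bounded below at every point of an arc.
  Unimodality, which differences of independent copies preserve, turns second and fourth moments
  into such a pointwise bound and stands in for a local limit theorem. For bounded \<open>t\<close>
  the cells hold too few points; there, moving one point around the cycle suffices.\<close>

abbreviation expect :: "'a pmf \<Rightarrow> ('a \<Rightarrow> real) \<Rightarrow> real" where
  "expect p f \<equiv> measure_pmf.expectation p f"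

lemma expect_eq_sum: "finite (set_pmf p) \<Longrightarrow> expect p f = (\<Sum>x\<in>set_pmf p. pmf p x * f x)"
  by (subst integral_measure_pmf_real[where A = "set_pmf p"]) (auto simp: mult.commute)

lemma prob_eq_expect: "measure_pmf.prob p {x. P x} = expect p (\<lambda>x. of_bool (P x))"
proof -
  have "expect p (\<lambda>x. of_bool (P x)) = expect p (indicator {x. P x})"
    by (intro arg_cong[of _ _ "expect p"]) (auto simp: indicator_def)
  then show ?thesis by simp
qed

lemma expect_mono:
  assumes "finite (set_pmf p)" "\<And>x. x \<in> set_pmf p \<Longrightarrow> f x \<le> g x"
  shows "expect p f \<le> expect p g"
  unfolding expect_eq_sum[OF assms(1)] by (intro sum_mono mult_left_mono assms) auto

lemma expect_cong: "(\<And>x. x \<in> set_pmf p \<Longrightarrow> f x = g x) \<Longrightarrow> expect p f = expect p g"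
  by (intro integral_cong_AE) (auto simp: AE_measure_pmf_iff)

lemma expect_add:
  assumes "finite (set_pmf p)"
  shows "expect p (\<lambda>x. f x + g x) = expect p f + expect p g"
  unfolding expect_eq_sum[OF assms] by (simp add: algebra_simps sum.distrib)

lemma expect_diff:
  assumes "finite (set_pmf p)"
  shows "expect p (\<lambda>x. f x - g x) = expect p f - expect p g"
  unfolding expect_eq_sum[OF assms] by (simp add: algebra_simps sum_subtractf)

lemma expect_sum_distrib:
  assumes "finite (set_pmf p)"
  shows "expect p (\<lambda>x. \<Sum>i\<in>I. f i x) = (\<Sum>i\<in>I. expect p (f i))"
  unfolding expect_eq_sum[OF assms] by (simp add: sum_distrib_left) (rule sum.swap)

lemma expect_nonneg: "(\<And>x. x \<in> set_pmf p \<Longrightarrow> 0 \<le> f x) \<Longrightarrow> 0 \<le> expect p f"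
  by (intro integral_nonneg_AE) (auto simp: AE_measure_pmf_iff)

lemma pmf_pair_pmf: "pmf (pair_pmf p q) x = pmf p (fst x) * pmf q (snd x)"
  using pmf_pair[of p q "fst x" "snd x"] by simp

lemma expect_pair:
  assumes "finite (set_pmf p)" "finite (set_pmf q)"
  shows "expect (pair_pmf p q) f = expect p (\<lambda>x. expect q (\<lambda>y. f (x, y)))"
  using assms
  by (simp add: expect_eq_sum sum.cartesian_product sum_distrib_left case_prod_beta pmf_pair_pmf mult.assoc)

lemma expect_swap:
  assumes "finite (set_pmf p)" "finite (set_pmf q)"
  shows "expect p (\<lambda>x. expect q (\<lambda>y. f x y)) = expect q (\<lambda>y. expect p (\<lambda>x. f x y))"
  using assms by (simp add: expect_eq_sum sum_distrib_left mult.left_commute) (rule sum.swap)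

lemma expect_square_le:
  assumes "finite (set_pmf p)"
  shows "(expect p f)\<^sup>2 \<le> expect p (\<lambda>x. (f x)\<^sup>2)"
proof -
  let ?m = "expect p f"
  have "0 \<le> expect p (\<lambda>x. (f x - ?m)\<^sup>2)" by (rule expect_nonneg) simp
  also have "\<dots> = expect p (\<lambda>x. ((f x)\<^sup>2 - (2 * ?m) * f x) + ?m\<^sup>2)"
    by (simp add: power2_eq_square algebra_simps)
  also have "\<dots> = expect p (\<lambda>x. (f x)\<^sup>2) - ?m\<^sup>2"
    by (subst expect_add[OF assms], subst expect_diff[OF assms]) (simp add: power2_eq_square)
  finally show ?thesis by simp
qed

lemma expect_not:
  assumes "finite (set_pmf p)"
  shows "expect p (\<lambda>x. of_bool (\<not> P x)) = 1 - expect p (\<lambda>x. of_bool (P x))"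
  using expect_diff[OF assms, of "\<lambda>_. 1" "\<lambda>x. of_bool (P x)"] by (simp add: of_bool_not_iff)

lemma finite_set_Pi_pmf:
  assumes "finite A" "\<And>x. x \<in> A \<Longrightarrow> finite (set_pmf (p x))"
  shows "finite (set_pmf (Pi_pmf A d p))"
  using assms by (subst set_Pi_pmf) (auto intro!: finite_PiE_dflt)

lemma expect_Pi_pmf_insert:
  assumes "finite A" "x \<notin> A" "finite (set_pmf q)"
  shows "expect (Pi_pmf (insert x A) d (\<lambda>_. q)) f = expect q (\<lambda>c. expect (Pi_pmf A d (\<lambda>_. q)) (\<lambda>g. f (g(x := c))))"
  using assms by (simp add: Pi_pmf_insert case_prod_unfold expect_pair finite_set_Pi_pmf)

lemma Pi_pmf_pair:
  assumes "finite A"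
  shows "Pi_pmf A (d, d') (\<lambda>x. pair_pmf (p x) (q x)) =
    map_pmf (\<lambda>(f, g) x. (f x, g x)) (pair_pmf (Pi_pmf A d p) (Pi_pmf A d' q))"
proof (rule pmf_eqI)
  fix h :: "'a \<Rightarrow> 'b \<times> 'c"
  have inj: "inj (\<lambda>(f, g) x. (f x, g x) :: 'b \<times> 'c)"
    by (auto simp: inj_on_def fun_eq_iff)
  have h: "h = (\<lambda>(f, g) x. (f x, g x)) (fst \<circ> h, snd \<circ> h)" by simp
  have "pmf (map_pmf (\<lambda>(f, g) x. (f x, g x)) (pair_pmf (Pi_pmf A d p) (Pi_pmf A d' q))) h
      = pmf (pair_pmf (Pi_pmf A d p) (Pi_pmf A d' q)) (fst \<circ> h, snd \<circ> h)"
    by (subst h, subst pmf_map_inj'[OF inj]) simp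
  also have "\<dots> = pmf (Pi_pmf A (d, d') (\<lambda>x. pair_pmf (p x) (q x))) h"
    using assms by (auto simp: pmf_pair_pmf pmf_Pi prod.distrib prod_eq_iff)
  finally show "pmf (Pi_pmf A (d, d') (\<lambda>x. pair_pmf (p x) (q x))) h =
     pmf (map_pmf (\<lambda>(f, g) x. (f x, g x)) (pair_pmf (Pi_pmf A d p) (Pi_pmf A d' q))) h" by simp
qed

lemma replicate_pmf_eq_map_Pi_pmf:
  "replicate_pmf t p = map_pmf (\<lambda>f. map f [0..<t]) (Pi_pmf {..<t} d (\<lambda>_. p))"
proof (induction t)
  case (Suc t)
  have "replicate_pmf (Suc t) p = do {xs \<leftarrow> replicate_pmf t p; x \<leftarrow> p; return_pmf (xs @ [x])}"
    using replicate_pmf_distrib[of t 1 p]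
    by (simp add: replicate_pmf_1 map_pmf_def bind_assoc_pmf bind_return_pmf)
  also have "\<dots> = do {x \<leftarrow> p; xs \<leftarrow> replicate_pmf t p; return_pmf (xs @ [x])}"
    by (rule bind_commute_pmf)
  also have "\<dots> = map_pmf (\<lambda>f. map f [0..<Suc t]) (Pi_pmf {..<Suc t} d (\<lambda>_. p))"
    unfolding Suc.IH lessThan_Suc
    by (subst Pi_pmf_insert')
       (auto simp: map_pmf_def bind_assoc_pmf bind_return_pmf intro!: bind_pmf_cong)
  finally show ?case .
qed auto

section \<open>Agreement of strategies along displacements\<close>

definition torus :: "nat \<Rightarrow> nat \<Rightarrow> (nat \<Rightarrow> int) pmf" where
  "torus n t = Pi_pmf {..<t} 0 (\<lambda>_. pmf_of_set {0..<int n})"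

text \<open>Positions are integers rather than residues, so that parities and lifts make sense; the
  provers see only the residues of the first \<open>t\<close> coordinates.\<close>

definition periodic :: "nat \<Rightarrow> nat \<Rightarrow> ((nat \<Rightarrow> int) \<Rightarrow> 'a) \<Rightarrow> bool" where
  "periodic n t F \<longleftrightarrow> (\<forall>X Y. (\<forall>i<t. X i mod int n = Y i mod int n) \<longrightarrow> F X = F Y)"

text \<open>
  A challenge moves every position by \<open>0\<close> or \<open>\<plusminus>1\<close>, and two answers must differ iff the displacement
  is odd. In this form the condition makes sense for arbitrary displacements and composes.
\<close>
definition agree :: "nat \<Rightarrow> ((nat \<Rightarrow> int) \<Rightarrow> nat \<Rightarrow> bool) \<Rightarrow> ((nat \<Rightarrow> int) \<Rightarrow> nat \<Rightarrow> bool) \<Rightarrow>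
    (nat \<Rightarrow> int) \<Rightarrow> (nat \<Rightarrow> int) \<Rightarrow> bool" where
  "agree t a a' X D \<longleftrightarrow> (\<forall>i<t. (a X i \<noteq> a' (\<lambda>i. X i + D i) i) = odd (D i))"

text \<open>For \<open>q = step_pmf\<close> this is the acceptance probability; other laws extend it
  to longer displacements.\<close>

definition agreement :: "nat \<Rightarrow> nat \<Rightarrow> ((nat \<Rightarrow> int) \<Rightarrow> nat \<Rightarrow> bool) \<Rightarrow>
    ((nat \<Rightarrow> int) \<Rightarrow> nat \<Rightarrow> bool) \<Rightarrow> int pmf \<Rightarrow> real" where
  "agreement n t a a' q = expect (Pi_pmf {..<t} 0 (\<lambda>_. q))
     (\<lambda>D. expect (torus n t) (\<lambda>X. of_bool (agree t a a' X D)))"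

lemma finite_set_torus: "n > 0 \<Longrightarrow> finite (set_pmf (torus n t))"
  unfolding torus_def by (intro finite_set_Pi_pmf) auto

lemma periodicD: "periodic n t F \<Longrightarrow> (\<And>i. i < t \<Longrightarrow> X i mod int n = Y i mod int n) \<Longrightarrow> F X = F Y"
  unfolding periodic_def by blast

lemma expect_torus_shift:
  assumes n: "n > 0" and F: "periodic n t F"
  shows "expect (torus n t) (\<lambda>X. F (\<lambda>i. X i + e i)) = expect (torus n t) F"
proof -
  define S where "S = PiE_dflt {..<t} (0::int) (\<lambda>_. {0..<int n})"
  \<comment> \<open>Reducing modulo \<open>n\<close> makes the translation a permutation of the
    canonical representatives; \<open>F\<close> does not notice the reduction.\<close>
  define g where "g = (\<lambda>X i. if i < t then (X i + e i) mod int n else (0::int))"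
  have S: "finite S" "S \<noteq> {}"
    using n by (auto simp: S_def intro!: finite_PiE_dflt)
  have torus: "torus n t = pmf_of_set S"
    unfolding torus_def S_def using n by (intro Pi_pmf_of_set) auto
  have "g ` S \<subseteq> S"
    using n by (auto simp: S_def g_def PiE_dflt_def)
  moreover have "inj_on g S"
  proof (rule inj_onI, rule ext)
    fix X Y i assume XY: "X \<in> S" "Y \<in> S" "g X = g Y"
    show "X i = Y i"
    proof (cases "i < t")
      case True
      then have "(X i + e i) mod int n = (Y i + e i) mod int n"
        using fun_cong[OF XY(3), of i] by (simp add: g_def)
      then have "X i mod int n = Y i mod int n"
        by (metis add_diff_cancel_right' mod_diff_left_eq)
      with True XY show ?thesis by (auto simp: S_def PiE_dflt_def)
    qed (use XY in \<open>auto simp: S_def PiE_dflt_def\<close>)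
  qed
  ultimately have bij: "bij_betw g S S"
    using S by (simp add: bij_betw_def endo_inj_surj)
  have "expect (torus n t) (\<lambda>X. F (\<lambda>i. X i + e i)) = (\<Sum>X\<in>S. F (g X)) / card S"
    unfolding torus
    by (subst integral_pmf_of_set[OF S(2,1)], rule arg_cong2[of _ _ _ _ "(/)"], rule sum.cong)
       (auto intro!: periodicD[OF F] simp: g_def)
  also have "(\<Sum>X\<in>S. F (g X)) = (\<Sum>X\<in>S. F X)"
    by (rule sum.reindex_bij_betw[OF bij])
  also have "\<dots> / card S = expect (torus n t) F"
    unfolding torus by (simp add: integral_pmf_of_set[OF S(2,1)])
  finally show ?thesis .
qed

lemma periodic_shift: "periodic n t F \<Longrightarrow> periodic n t (\<lambda>X. F (\<lambda>i. X i + e i))"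
  unfolding periodic_def[of _ _ "\<lambda>X. F (\<lambda>i. X i + e i)"]
  by (intro allI impI, rule periodicD) (auto intro: mod_add_cong)

lemma periodic_comp: "periodic n t F \<Longrightarrow> periodic n t (\<lambda>X. g (F X))"
  unfolding periodic_def by metis

lemma periodic_agree:
  assumes "periodic n t a" "periodic n t a'"
  shows "periodic n t (\<lambda>X. agree t a a' X D)"
  unfolding periodic_def agree_def
proof (intro allI impI)
  fix X Y :: "nat \<Rightarrow> int" assume XY: "\<forall>i<t. X i mod int n = Y i mod int n"
  have "a X = a Y" using XY by (intro periodicD[OF assms(1)]) auto
  moreover have "a' (\<lambda>i. X i + D i) = a' (\<lambda>i. Y i + D i)"
    using XY by (intro periodicD[OF periodic_shift[OF assms(2)]]) auto
  ultimately show "(\<forall>i<t. (a X i \<noteq> a' (\<lambda>i. X i + D i) i) = odd (D i)) =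
      (\<forall>i<t. (a Y i \<noteq> a' (\<lambda>i. Y i + D i) i) = odd (D i))" by simp
qed

lemma agree_trans:
  assumes "agree t a a' X D" "agree t a' a'' (\<lambda>i. X i + D i) D'"
  shows "agree t a a'' X (\<lambda>i. D i + D' i)"
  using assms unfolding agree_def by (auto simp: add.assoc)

lemma agree_sym:
  "agree t a a' (\<lambda>i. X i + D i) (\<lambda>i. - D i) \<longleftrightarrow> agree t a' a X D"
  unfolding agree_def by auto

text \<open>
  Both sides are averages over a uniform midpoint \<open>X\<close>: if \<open>X + D\<close> and \<open>X + D'\<close> both agree with
  \<open>X\<close>, then they agree with each other.
\<close>
lemma agreement_square_le:
  assumes n: "n > 0" and a: "periodic n t a" "periodic n t a'" and q: "finite (set_pmf q)"
  shows "(agreement n t a' a q)\<^sup>2 \<le> agreement n t a a (map_pmf (\<lambda>(x, y). x - y) (pair_pmf q q))"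
proof -
  let ?Q = "Pi_pmf {..<t} (0::int) (\<lambda>_. q)"
  let ?T = "torus n t"
  have fin: "finite (set_pmf ?Q)" "finite (set_pmf ?T)" "finite (set_pmf (pair_pmf ?Q ?Q))"
    using q n by (auto intro!: finite_set_Pi_pmf finite_set_torus)
  have eq: "Pi_pmf {..<t} 0 (\<lambda>_. map_pmf (\<lambda>(x, y). x - y) (pair_pmf q q)) =
      map_pmf (\<lambda>(D, D') i. D i - D' i) (pair_pmf ?Q ?Q)"
    by (subst Pi_pmf_map[where dflt = "(0, 0)"], simp, simp, subst Pi_pmf_pair)
       (auto simp: pmf.map_comp o_def case_prod_unfold)
  have "(agreement n t a' a q)\<^sup>2 = (expect ?T (\<lambda>X. expect ?Q (\<lambda>D. of_bool (agree t a' a X D))))\<^sup>2"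
    unfolding agreement_def by (subst expect_swap[OF fin(1,2)]) simp
  also have "\<dots> \<le> expect ?T (\<lambda>X. (expect ?Q (\<lambda>D. of_bool (agree t a' a X D)))\<^sup>2)"
    by (rule expect_square_le[OF fin(2)])
  also have "\<dots> = expect ?T (\<lambda>X. expect (pair_pmf ?Q ?Q)
      (\<lambda>(D, D'). of_bool (agree t a' a X D) * of_bool (agree t a' a X D')))"
    by (subst expect_pair[OF fin(1,1)]) (simp add: power2_eq_square)
  also have "\<dots> = expect (pair_pmf ?Q ?Q) (\<lambda>(D, D'). expect ?T
      (\<lambda>X. of_bool (agree t a' a X D) * of_bool (agree t a' a X D')))"
    by (subst expect_swap[OF fin(2,3)]) (simp add: case_prod_unfold)
  also have "\<dots> \<le> expect (pair_pmf ?Q ?Q) (\<lambda>(D, D'). expect ?T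
      (\<lambda>X. of_bool (agree t a a (\<lambda>i. X i + D' i) (\<lambda>i. D i - D' i))))"
  proof (rule expect_mono[OF fin(3)], clarify, rule expect_mono[OF fin(2)])
    fix X D D' :: "nat \<Rightarrow> int"
    have "agree t a a (\<lambda>i. X i + D' i) (\<lambda>i. D i - D' i)"
      if "agree t a' a X D" "agree t a' a X D'"
      using agree_trans[OF iffD2[OF agree_sym that(2)], of a "D"] that(1)
      by simp
    then show "of_bool (agree t a' a X D) * of_bool (agree t a' a X D')
        \<le> (of_bool (agree t a a (\<lambda>i. X i + D' i) (\<lambda>i. D i - D' i)) :: real)"
      by auto
  qed
  \<comment> \<open>For fixed \<open>D'\<close> the point \<open>X + D'\<close> is again uniform and
    may be renamed \<open>X\<close>.\<close>
  also have "\<dots> = expect (pair_pmf ?Q ?Q) (\<lambda>(D, D'). expect ?T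
      (\<lambda>X. of_bool (agree t a a X (\<lambda>i. D i - D' i))))"
    by (subst expect_torus_shift[OF n periodic_comp[OF periodic_agree[OF a(1) a(1)]]]) simp
  also have "\<dots> = agreement n t a a (map_pmf (\<lambda>(x, y). x - y) (pair_pmf q q))"
    unfolding agreement_def eq by (simp add: case_prod_unfold)
  finally show ?thesis .
qed

section \<open>Straight paths\<close>

definition step_pmf :: "int pmf" where
  "step_pmf = bind_pmf (bernoulli_pmf (1 / 2)) (\<lambda>same. if same then return_pmf 0 else pmf_of_set {-1, 1})"

definition walk_pmf :: "nat \<Rightarrow> (bool \<times> bool \<times> nat) pmf" where
  "walk_pmf T = pmf_of_set (UNIV \<times> UNIV \<times> {..T})"

text \<open>
  Position after \<open>k\<close> of \<open>T\<close> steps of the walk that moves in direction \<open>s\<close> during the first (if \<open>b\<close>)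
  or last \<open>m\<close> steps. For uniform \<open>(b, m)\<close> it moves in every step with probability \<open>1/2\<close>.
\<close>
fun walk_pos :: "nat \<Rightarrow> nat \<Rightarrow> bool \<times> bool \<times> nat \<Rightarrow> int" where
  "walk_pos T k (s, b, m) = (if s then 1 else -1) * (if b then int (min k m) else int (k - (T - m)))"

definition jump_pmf :: "nat \<Rightarrow> int pmf" where
  "jump_pmf T = map_pmf (walk_pos T T) (walk_pmf T)"

lemma set_walk_pmf: "set_pmf (walk_pmf T) = UNIV \<times> UNIV \<times> {..T}"
  unfolding walk_pmf_def by (intro set_pmf_of_set) auto

lemma pmf_map_walk_pmf:
  "pmf (map_pmf f (walk_pmf T)) x = card {w \<in> UNIV \<times> UNIV \<times> {..T}. f w = x} / (4 * (real T + 1))"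
  unfolding pmf_map walk_pmf_def
  by (subst measure_pmf_of_set) (auto simp: card_cartesian_product vimage_def Int_def intro!: arg_cong[of _ _ card])

lemma pmf_step_pmf:
  "pmf step_pmf x = (if x = 0 then 1/2 else if x = 1 \<or> x = -1 then 1/4 else 0)"
  unfolding step_pmf_def pmf_bind
  by (subst integral_measure_pmf[where A = UNIV]) (auto simp: UNIV_bool pmf_of_set indicator_def)

lemma finite_set_step_pmf: "finite (set_pmf step_pmf)"
  by (rule finite_subset[of _ "{0, 1, -1}"]) (auto simp: set_pmf_eq pmf_step_pmf)

lemma map_uminus_step_pmf: "map_pmf uminus step_pmf = step_pmf"
proof (rule pmf_eqI)
  fix x :: int
  have "pmf (map_pmf uminus step_pmf) (- (-x)) = pmf step_pmf (-x)"
    by (rule pmf_map_inj') (auto simp: inj_on_def)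
  then show "pmf (map_pmf uminus step_pmf) x = pmf step_pmf x"
    by (auto simp: pmf_step_pmf)
qed

text \<open>In step \<open>k\<close> the walk moves for \<open>T - k\<close> values of
  \<open>m\<close> if \<open>b\<close> holds and for \<open>k + 1\<close> values otherwise. Neither
  count is constant in \<open>k\<close>, but their sum \<open>T + 1\<close> is half of all pairs
  \<open>(b, m)\<close>.\<close>

lemma walk_step_law:
  assumes k: "k < T"
  shows "map_pmf (\<lambda>w. walk_pos T (Suc k) w - walk_pos T k w) (walk_pmf T) = step_pmf"
proof (rule pmf_eqI)
  fix x :: int
  let ?f = "\<lambda>w. walk_pos T (Suc k) w - walk_pos T k w"
  let ?W = "UNIV \<times> UNIV \<times> {..T} :: (bool \<times> bool \<times> nat) set"
  let ?M = "{True} \<times> {k<..T} \<union> {False} \<times> {T - k..T}"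
  have f: "?f w = (case w of (s, bm) \<Rightarrow> if bm \<in> ?M then if s then 1 else -1 else 0)" if "w \<in> ?W" for w
    using k that by (cases w) (auto simp: min_def)
  have eq: "{w \<in> ?W. ?f w = x} = {w \<in> ?W. (case w of (s, bm) \<Rightarrow> if bm \<in> ?M then if s then 1 else -1 else 0) = x}"
    for x by (rule Collect_cong) (use f in auto)
  have M: "card ?M = T + 1"
    using k by (subst card_Un_disjoint) (auto simp: card_cartesian_product)
  have 1: "{w \<in> ?W. ?f w = x} = {x = 1} \<times> ?M" if "x = 1 \<or> x = -1"
    unfolding eq using that k by (auto split: if_splits)
  have 0: "{w \<in> ?W. ?f w = 0} = UNIV \<times> ({True} \<times> {..k} \<union> {False} \<times> {..<T - k})"
    unfolding eq using k by (auto split: if_splits)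
  have 2: "{w \<in> ?W. ?f w = x} = {}" if "x \<noteq> 1" "x \<noteq> -1" "x \<noteq> 0"
    unfolding eq using that by (auto split: if_splits)
  have c0: "card (UNIV \<times> ({True} \<times> {..k} \<union> {False} \<times> {..<T - k}) :: (bool \<times> bool \<times> nat) set) = 2 * (T + 1)"
    using k by (subst card_cartesian_product, subst card_Un_disjoint) (auto simp: card_cartesian_product)
  show "pmf (map_pmf ?f (walk_pmf T)) x = pmf step_pmf x"
    unfolding pmf_map_walk_pmf pmf_step_pmf
    using 0 1 2 c0 M by (auto simp: card_cartesian_product divide_simps simp del: walk_pos.simps)
qed

lemma disagreement:
  assumes "n > 0" "finite (set_pmf q)"
  shows "1 - agreement n t a a' q = expect (Pi_pmf {..<t} 0 (\<lambda>_. q))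
     (\<lambda>D. expect (torus n t) (\<lambda>X. of_bool (\<not> agree t a a' X D)))"
proof -
  have "finite (set_pmf (Pi_pmf {..<t} 0 (\<lambda>_. q)))"
    using assms by (intro finite_set_Pi_pmf) auto
  then show ?thesis
    by (simp add: agreement_def expect_not[OF finite_set_torus[OF assms(1)]] expect_diff)
qed

text \<open>Reversing the displacement exchanges the provers. As \<open>step_pmf\<close> is
  symmetric, steps from \<open>a'\<close> to \<open>a\<close> cost the same as steps from
  \<open>a\<close> to \<open>a'\<close>.\<close>

lemma agreement_commute:
  assumes n: "n > 0" and a: "periodic n t a" "periodic n t a'"
  shows "agreement n t a' a q = agreement n t a a' (map_pmf uminus q)"
proof -
  have "agreement n t a a' (map_pmf uminus q) =
     expect (Pi_pmf {..<t} 0 (\<lambda>_. q)) (\<lambda>D. expect (torus n t) (\<lambda>X. of_bool (agree t a a' X (\<lambda>i. - D i))))"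
    unfolding agreement_def by (subst Pi_pmf_map[where dflt = 0]) (auto simp: o_def)
  also have "\<dots> = expect (Pi_pmf {..<t} 0 (\<lambda>_. q)) (\<lambda>D. expect (torus n t)
      (\<lambda>X. of_bool (agree t a a' (\<lambda>i. X i + D i) (\<lambda>i. - D i))))"
    by (subst expect_torus_shift[OF n periodic_comp[OF periodic_agree[OF a]]]) simp
  also have "\<dots> = agreement n t a' a q"
    unfolding agree_sym agreement_def ..
  finally show ?thesis ..
qed

lemma finite_set_jump_pmf: "finite (set_pmf (jump_pmf T))"
  by (simp add: jump_pmf_def set_walk_pmf)

text \<open>
  A coordinate moves during a random half of \<open>T\<close> unit steps, always in the same direction. Each
  single step of this walk is distributed as the challenge, so a union bound over the \<open>T\<close> steps
  controls a jump of size of order \<open>T\<close>.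
\<close>
lemma agreement_jump_ge:
  assumes n: "n > 0" and a: "periodic n t a" "periodic n t a'" and T: "even T"
  shows "1 - real T * (1 - agreement n t a a' step_pmf) \<le> agreement n t a a (jump_pmf T)"
proof -
  \<comment> \<open>The default \<open>(True, True, 0)\<close> is a walk that never moves, matching
    the default displacement 0.\<close>
  define W where "W = Pi_pmf {..<t} (True, True, 0) (\<lambda>_. walk_pmf T)"
  define P where "P = (\<lambda>k w i :: nat. walk_pos T k (w i))"
  \<comment> \<open>The two strategies alternate along the path, so every step is a challenge
    between the provers; as \<open>T\<close> is even, the path ends at \<open>a\<close>
    again.\<close>
  define c where "c = (\<lambda>k::nat. if even k then a else a')"
  let ?X = "torus n t"
  have fin: "finite (set_pmf W)" "finite (set_pmf ?X)"
    using n unfolding W_def by (auto intro!: finite_set_Pi_pmf finite_set_torus simp: set_walk_pmf)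
  have c: "periodic n t (c k)" for k using a by (simp add: c_def)
  have chain: "agree t a (c k) X (P k w)"
    if "w \<in> set_pmf W" "\<forall>j<k. agree t (c j) (c (Suc j)) (\<lambda>i. X i + P j w i) (\<lambda>i. P (Suc j) w i - P j w i)"
    for k X w
    using that(2)
  proof (induction k)
    case 0
    have "P 0 w i = 0" for i by (cases "w i") (simp add: P_def)
    then show ?case by (simp add: agree_def c_def)
  next
    case (Suc k)
    then show ?case
      using agree_trans[of t a "c k" X "P k w" "c (Suc k)" "\<lambda>i. P (Suc k) w i - P k w i"] by simp
  qed
  have step: "expect W (\<lambda>w. expect ?X (\<lambda>X. of_bool (\<not> agree t (c k) (c (Suc k)) (\<lambda>i. X i + P k w i)
      (\<lambda>i. P (Suc k) w i - P k w i)))) = 1 - agreement n t a a' step_pmf" (is "?L = _") if "k < T" for k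
  proof -
    note per = periodic_comp[OF periodic_agree[OF c c], of "\<lambda>x. of_bool (\<not> x)"]
    \<comment> \<open>For a fixed walk the position before the step is still uniform.\<close>
    have "?L = expect W (\<lambda>w. expect ?X (\<lambda>X. of_bool (\<not> agree t (c k) (c (Suc k)) X
      (\<lambda>i. P (Suc k) w i - P k w i))))"
      by (subst expect_torus_shift[OF n per]) simp
    also have "\<dots> = 1 - agreement n t (c k) (c (Suc k))
        (map_pmf (\<lambda>w. walk_pos T (Suc k) w - walk_pos T k w) (walk_pmf T))"
      using n unfolding W_def
      by (subst disagreement, simp, simp add: set_walk_pmf, subst Pi_pmf_map[where dflt = "(True, True, 0)"])
         (auto simp: P_def o_def)
    also have "\<dots> = 1 - agreement n t (c k) (c (Suc k)) step_pmf"
      unfolding walk_step_law[OF that] ..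
    also have "agreement n t (c k) (c (Suc k)) step_pmf = agreement n t a a' step_pmf"
      using agreement_commute[OF n a, of step_pmf] by (simp add: c_def map_uminus_step_pmf)
    finally show ?thesis .
  qed
  have "1 - agreement n t a a (jump_pmf T) = expect W (\<lambda>w. expect ?X (\<lambda>X. of_bool (\<not> agree t a a X (P T w))))"
    unfolding disagreement[OF n finite_set_jump_pmf] W_def unfolding jump_pmf_def
    by (subst Pi_pmf_map[where dflt = "(True, True, 0)"]) (auto simp: P_def o_def)
  also have "\<dots> \<le> expect W (\<lambda>w. expect ?X (\<lambda>X. \<Sum>k<T. of_bool (\<not> agree t (c k) (c (Suc k))
      (\<lambda>i. X i + P k w i) (\<lambda>i. P (Suc k) w i - P k w i))))"
  proof (rule expect_mono[OF fin(1)], rule expect_mono[OF fin(2)])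
    fix w X assume w: "w \<in> set_pmf W"
    let ?g = "\<lambda>k. agree t (c k) (c (Suc k)) (\<lambda>i. X i + P k w i) (\<lambda>i. P (Suc k) w i - P k w i)"
    show "of_bool (\<not> agree t a a X (P T w)) \<le> (\<Sum>k<T. of_bool (\<not> ?g k) :: real)"
    proof (cases "\<forall>k<T. ?g k")
      case True
      then have "agree t a a X (P T w)" using chain[OF w, of T X] T by (simp add: c_def)
      then show ?thesis by (simp add: sum_nonneg)
    next
      case False
      then obtain k where k: "k < T" "\<not> ?g k" by blast
      have "of_bool (\<not> ?g k) \<le> (\<Sum>k<T. of_bool (\<not> ?g k) :: real)"
        using k by (intro member_le_sum) auto
      then show ?thesis using k by auto
    qed
  qed
  also have "\<dots> = (\<Sum>k<T. 1 - agreement n t a a' step_pmf)"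
    by (subst expect_sum_distrib[OF fin(2)], subst expect_sum_distrib[OF fin(1)], rule sum.cong) (auto simp: step)
  finally show ?thesis by simp
qed

section \<open>Spread of iterated jumps\<close>

definition diff_pmf :: "int pmf \<Rightarrow> int pmf" where
  "diff_pmf p = map_pmf (\<lambda>(x, y). x - y) (pair_pmf p p)"

text \<open>The case \<open>\<bar>x\<bar> = \<bar>y\<bar>\<close>, used in both directions, includes
  symmetry.\<close>

definition unimodal :: "int pmf \<Rightarrow> bool" where
  "unimodal p \<longleftrightarrow> (\<forall>x y. \<bar>x\<bar> \<le> \<bar>y\<bar> \<longrightarrow> pmf p y \<le> pmf p x)"

lemma finite_set_diff_pmf: "finite (set_pmf p) \<Longrightarrow> finite (set_pmf (diff_pmf p))"
  by (simp add: diff_pmf_def)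

lemma unimodal_uminus: "unimodal p \<Longrightarrow> pmf p (- x) = pmf p x"
  unfolding unimodal_def by (simp add: order_antisym)

lemma pmf_diff_pmf:
  assumes "finite A" "set_pmf p \<subseteq> A"
  shows "pmf (diff_pmf p) d = (\<Sum>x\<in>A. pmf p x * pmf p (x - d))"
proof -
  have fin: "finite (set_pmf p)" using assms finite_subset by blast
  have "pmf (diff_pmf p) d = expect (pair_pmf p p) (\<lambda>z. of_bool (fst z - snd z = d))"
    unfolding diff_pmf_def pmf_map by (simp add: vimage_def prob_eq_expect case_prod_unfold)
  also have "\<dots> = expect p (\<lambda>x. expect p (\<lambda>y. of_bool (x - y = d)))"
    by (subst expect_pair[OF fin fin]) simp
  also have "\<dots> = expect p (\<lambda>x. pmf p (x - d))"
  proof (rule expect_cong)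
    fix x
    have "{y. x - y = d} = {x - d}" by auto
    then show "expect p (\<lambda>y. of_bool (x - y = d)) = pmf p (x - d)"
      by (simp flip: prob_eq_expect add: measure_pmf_single)
  qed
  also have "\<dots> = (\<Sum>x\<in>A. pmf p (x - d) * pmf p x)"
    using assms by (intro integral_measure_pmf_real) auto
  finally show ?thesis by (simp add: mult.commute)
qed

lemma diff_pmf_uminus: "finite (set_pmf p) \<Longrightarrow> pmf (diff_pmf p) (- d) = pmf (diff_pmf p) d"
proof -
  assume fin: "finite (set_pmf p)"
  define A where "A = set_pmf p \<union> (\<lambda>x. x + d) ` set_pmf p"
  define A' where "A' = set_pmf p \<union> (\<lambda>x. x - d) ` set_pmf p"
  have "pmf (diff_pmf p) d = (\<Sum>x\<in>A. pmf p x * pmf p (x - d))"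
    by (rule pmf_diff_pmf) (use fin in \<open>auto simp: A_def\<close>)
  also have "\<dots> = (\<Sum>x\<in>A'. pmf p (x + d) * pmf p x)"
    by (rule sum.reindex_bij_witness[of _ "\<lambda>x. x + d" "\<lambda>x. x - d"]) (auto simp: A_def A'_def image_iff)
  also have "\<dots> = pmf (diff_pmf p) (- d)"
    by (subst pmf_diff_pmf[of A']) (use fin in \<open>auto simp: A'_def mult.commute\<close>)
  finally show ?thesis ..
qed

text \<open>
  The forward difference \<open>\<Delta>\<close> of a symmetric unimodal function is antisymmetric about \<open>-1/2\<close>.
  Averaging the sum for the increment of the convolution with its reflection makes every term
  nonnegative.
\<close>
lemma unimodal_diff_pmf:
  assumes p: "unimodal p" and fin: "finite (set_pmf p)"
  shows "unimodal (diff_pmf p)"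
proof -
  define f where "f = pmf p"
  define g where "g = pmf (diff_pmf p)"
  have sym: "f (- x) = f x" for x using unimodal_uminus[OF p] by (simp add: f_def)
  have mono: "f y \<le> f x" if "\<bar>x\<bar> \<le> \<bar>y\<bar>" for x y
    using p that unfolding unimodal_def f_def by blast
  have antimono: "g (d + 1) \<le> g d" if d: "0 \<le> d" for d
  proof -
    obtain N where N: "\<And>x. x \<in> set_pmf p \<Longrightarrow> \<bar>x\<bar> \<le> N"
    proof
      fix x assume "x \<in> set_pmf p"
      then show "\<bar>x\<bar> \<le> Max (abs ` set_pmf p)" using fin by (intro Max_ge) auto
    qed
    \<comment> \<open>Wide enough for the translate of \<open>I\<close> by \<open>d + 1\<close> to
      contain the support; \<open>I\<close> is half-open to be invariant under the reflection
      \<open>- u - 1\<close>.\<close>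
    define M where "M = N + d + 2"
    define \<Delta> where "\<Delta> = (\<lambda>u. f u - f (u + 1))"
    define I where "I = {-M..<M}"
    have reindex: "g e = (\<Sum>u\<in>I. f (u + d + 1) * f (u + d + 1 - e))" for e
    proof -
      have "g e = (\<Sum>x\<in>{-M + d + 1..<M + d + 1}. f x * f (x - e))"
        unfolding g_def f_def using N d
        by (intro pmf_diff_pmf) (force simp: M_def)+
      also have "\<dots> = (\<Sum>u\<in>I. f (u + d + 1) * f (u + d + 1 - e))"
        by (rule sum.reindex_bij_witness[of _ "\<lambda>u. u + d + 1" "\<lambda>x. x - d - 1"]) (auto simp: I_def)
      finally show ?thesis .
    qed
    have 1: "g d - g (d + 1) = - (\<Sum>u\<in>I. f (u + d + 1) * \<Delta> u)"
    proof -
      have "u + d + 1 - d = u + 1" "u + d + 1 - (d + 1) = u" for u by simp_all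
      then show ?thesis
        by (simp only: reindex \<Delta>_def right_diff_distrib sum_subtractf minus_diff_eq)
    qed
    have "(\<Sum>u\<in>I. f (u + d + 1) * \<Delta> u) = (\<Sum>u\<in>I. f (- u + d) * \<Delta> (- u - 1))"
      by (rule sum.reindex_bij_witness[of _ "\<lambda>u. - u - 1" "\<lambda>u. - u - 1"]) (auto simp: I_def add_ac)
    also have "\<dots> = - (\<Sum>u\<in>I. f (d - u) * \<Delta> u)"
    proof -
      have "\<Delta> (- u - 1) = - \<Delta> u" for u
        using sym[of u] sym[of "u + 1"] by (simp add: \<Delta>_def)
      then show ?thesis by (simp add: sum_negf)
    qed
    finally have 2: "g d - g (d + 1) = (\<Sum>u\<in>I. f (d - u) * \<Delta> u)" using 1 by simp
    have "0 \<le> (\<Sum>u\<in>I. (f (d - u) - f (u + d + 1)) * \<Delta> u)"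
    proof (rule sum_nonneg)
      \<comment> \<open>Both factors have the sign of \<open>u + 1/2\<close>: for
        \<open>u \<ge> 0\<close> the points \<open>d - u\<close> and \<open>u\<close> are closer to
        0 than \<open>u + d + 1\<close> and \<open>u + 1\<close>, and for \<open>u < 0\<close> at
        least as far away.\<close>
      fix u
      show "0 \<le> (f (d - u) - f (u + d + 1)) * \<Delta> u"
      proof (cases "u \<ge> 0")
        case True
        then show ?thesis using d
          by (intro mult_nonneg_nonneg) (auto simp: \<Delta>_def intro!: mono)
      next
        case False
        then show ?thesis using d
          by (intro mult_nonpos_nonpos) (auto simp: \<Delta>_def intro!: mono)
      qed
    qed
    also have "\<dots> = 2 * (g d - g (d + 1))"
      using 1 2 by (simp add: left_diff_distrib sum_subtractf)
    finally show ?thesis by simp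
  qed
  have nat_mono: "g y \<le> g x" if "0 \<le> x" "x \<le> y" for x y
    using that(2)
  proof (induction rule: int_ge_induct)
    case (step y)
    then show ?case using antimono[of y] that(1) by linarith
  qed simp
  have abs: "g x = g \<bar>x\<bar>" for x
    using diff_pmf_uminus[OF fin] unfolding g_def by (simp add: abs_if)
  show ?thesis
    unfolding unimodal_def g_def[symmetric]
  proof (intro allI impI)
    fix x y :: int assume "\<bar>x\<bar> \<le> \<bar>y\<bar>"
    then show "g y \<le> g x" using nat_mono[of "\<bar>x\<bar>" "\<bar>y\<bar>"] abs[of x] abs[of y] by simp
  qed
qed

definition moment :: "nat \<Rightarrow> int pmf \<Rightarrow> real" where
  "moment j p = expect p (\<lambda>x. real_of_int x ^ j)"

lemma moment_1_unimodal:
  assumes "unimodal p"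
  shows "moment 1 p = 0"
proof -
  have "map_pmf uminus p = p"
  proof (rule pmf_eqI)
    fix x :: int
    have "pmf (map_pmf uminus p) (- (-x)) = pmf p (-x)"
      by (rule pmf_map_inj') (auto simp: inj_on_def)
    then show "pmf (map_pmf uminus p) x = pmf p x"
      using unimodal_uminus[OF assms, of x] by simp
  qed
  then have "moment 1 p = expect (map_pmf uminus p) real_of_int" by (simp add: moment_def)
  also have "\<dots> = - moment 1 p" by (simp add: moment_def)
  finally show ?thesis by simp
qed

lemma moments_diff_pmf:
  assumes "finite (set_pmf p)" "moment 1 p = 0"
  shows "moment 2 (diff_pmf p) = 2 * moment 2 p"
    and "moment 4 (diff_pmf p) = 2 * moment 4 p + 6 * (moment 2 p)\<^sup>2"
proof -
  note E = expect_add[OF assms(1)] expect_diff[OF assms(1)]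
  have m1: "expect p real_of_int = 0" using assms(2) by (simp add: moment_def)
  have "moment 2 (diff_pmf p) = expect p (\<lambda>x. expect p (\<lambda>y. (real_of_int x - real_of_int y) ^ 2))"
    unfolding moment_def diff_pmf_def by (simp add: expect_pair assms(1) case_prod_unfold)
  also have "\<dots> = expect p (\<lambda>x. expect p (\<lambda>y. real_of_int x ^ 2 + real_of_int y ^ 2 - (2 * real_of_int x) * real_of_int y))"
    by (simp add: power2_diff)
  also have "\<dots> = 2 * moment 2 p"
    by (simp add: E m1 moment_def)
  finally show "moment 2 (diff_pmf p) = 2 * moment 2 p" .
  have "moment 4 (diff_pmf p) = expect p (\<lambda>x. expect p (\<lambda>y. (real_of_int x - real_of_int y) ^ 4))"
    unfolding moment_def diff_pmf_def by (simp add: expect_pair assms(1) case_prod_unfold)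
  also have "\<dots> = expect p (\<lambda>x. expect p (\<lambda>y. real_of_int x ^ 4 + real_of_int y ^ 4
      + (6 * real_of_int x ^ 2) * real_of_int y ^ 2 - (4 * real_of_int x ^ 3) * real_of_int y
      - (4 * real_of_int x) * real_of_int y ^ 3))"
    by (simp add: algebra_simps power4_eq_xxxx power2_eq_square power3_eq_cube)
  also have "\<dots> = 2 * moment 4 p + 6 * (moment 2 p)\<^sup>2"
    by (simp add: E m1 moment_def) (simp add: power2_eq_square)
  finally show "moment 4 (diff_pmf p) = 2 * moment 4 p + 6 * (moment 2 p)\<^sup>2" .
qed

lemma card_int_abs_le:
  fixes R :: real
  assumes "0 \<le> R"
  shows "real (card {x::int. x \<noteq> 0 \<and> \<bar>real_of_int x\<bar> \<le> R}) \<le> 2 * R" "finite {x::int. x \<noteq> 0 \<and> \<bar>real_of_int x\<bar> \<le> R}"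
proof -
  have eq: "{x::int. x \<noteq> 0 \<and> \<bar>real_of_int x\<bar> \<le> R} = {- \<lfloor>R\<rfloor>..-1} \<union> {1..\<lfloor>R\<rfloor>}"
    by (auto; linarith)
  show "finite {x::int. x \<noteq> 0 \<and> \<bar>real_of_int x\<bar> \<le> R}" unfolding eq by simp
  have "0 \<le> \<lfloor>R\<rfloor>" using assms by simp
  then have "card ({- \<lfloor>R\<rfloor>..-1} \<union> {1..\<lfloor>R\<rfloor>}) = 2 * nat \<lfloor>R\<rfloor>"
    by (subst card_Un_disjoint) auto
  then show "real (card {x::int. x \<noteq> 0 \<and> \<bar>real_of_int x\<bar> \<le> R}) \<le> 2 * R"
    unfolding eq using assms by simp
qed

text \<open>
  By the fourth moment bound a constant fraction of the mass lies at distance between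
  \<open>sqrt v / 2\<close> and \<open>sqrt (12 v)\<close>, and unimodality transports it towards the centre.
\<close>
lemma unimodal_pmf_ge:
  assumes p: "unimodal p" "finite (set_pmf p)"
    and v: "v = moment 2 p" "0 < v" and m4: "moment 4 p \<le> 3 * v\<^sup>2"
    and d: "\<bar>real_of_int d\<bar> \<le> sqrt v / 2"
  shows "1 / (200 * sqrt v) \<le> pmf p d"
proof -
  define R where "R = sqrt (12 * v)"
  define B where "B = {x::int. sqrt v / 2 < \<bar>real_of_int x\<bar> \<and> \<bar>real_of_int x\<bar> \<le> R}"
  have R0: "0 \<le> R" using v by (simp add: R_def)
  have B: "finite B" "real (card B) \<le> 2 * R"
  proof -
    have sub: "B \<subseteq> {x::int. x \<noteq> 0 \<and> \<bar>real_of_int x\<bar> \<le> R}"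
      using v by (auto simp: B_def)
    then show "finite B" by (rule finite_subset) (rule card_int_abs_le[OF R0])
    have "card B \<le> card {x::int. x \<noteq> 0 \<and> \<bar>real_of_int x\<bar> \<le> R}"
      by (rule card_mono[OF card_int_abs_le(2)[OF R0] sub])
    then show "real (card B) \<le> 2 * R" using card_int_abs_le(1)[OF R0] by linarith
  qed
  \<comment> \<open>The three terms dominate \<open>x^2\<close> near 0, on \<open>B\<close> and
    beyond \<open>R\<close>. The factor 12 makes the fourth moment term at most
    \<open>v / 4\<close>, which leaves \<open>v / 2\<close> for \<open>B\<close> and hence mass at
    least 1/24.\<close>
  have "v \<le> expect p (\<lambda>x. v / 4 + 12 * v * of_bool (x \<in> B) + (1 / (12 * v)) * real_of_int x ^ 4)"
    unfolding v(1) moment_def[of 2]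
  proof (rule expect_mono[OF p(2)], unfold moment_def[of 2, symmetric] v(1)[symmetric])
    fix x :: int
    let ?y = "\<bar>real_of_int x\<bar>"
    have sq: "real_of_int x ^ 2 = ?y ^ 2" "real_of_int x ^ 4 = ?y ^ 2 * ?y ^ 2"
      by (simp_all add: power_even_abs flip: power_add)
    have nonneg: "0 \<le> 12 * v * of_bool (x \<in> B)" "0 \<le> (1 / (12 * v)) * real_of_int x ^ 4"
      using v(2) by simp_all
    consider "?y \<le> sqrt v / 2" | "x \<in> B" | "R \<le> ?y" by (fastforce simp: B_def)
    then show "real_of_int x ^ 2 \<le> v / 4 + 12 * v * of_bool (x \<in> B) + (1 / (12 * v)) * real_of_int x ^ 4"
    proof cases
      case 1
      then have "?y ^ 2 \<le> (sqrt v / 2) ^ 2" by (intro power_mono) auto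
      also have "\<dots> = v / 4" using v(2) by (simp add: power_divide)
      finally show ?thesis using nonneg sq by linarith
    next
      case 2
      then have "?y ^ 2 \<le> R ^ 2" by (intro power_mono) (auto simp: B_def)
      also have "\<dots> = 12 * v" using v(2) by (simp add: R_def)
      also have "\<dots> = 12 * v * of_bool (x \<in> B)" using 2 by simp
      finally show ?thesis using nonneg sq v(2) by linarith
    next
      case 3
      then have "R ^ 2 \<le> ?y ^ 2" using R0 by (intro power_mono) auto
      then have "12 * v \<le> ?y ^ 2" using v(2) by (simp add: R_def)
      then have "12 * v * ?y ^ 2 \<le> ?y ^ 2 * ?y ^ 2" by (intro mult_right_mono) auto
      then have "?y ^ 2 \<le> (1 / (12 * v)) * (?y ^ 2 * ?y ^ 2)"
        using v(2) by (simp add: field_simps)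
      then show ?thesis using nonneg v(2) unfolding sq by linarith
    qed
  qed
  also have "\<dots> = v / 4 + 12 * v * expect p (\<lambda>x. of_bool (x \<in> B)) + (1 / (12 * v)) * moment 4 p"
    by (simp add: expect_add[OF p(2)] moment_def)
  also have "\<dots> \<le> v / 4 + 12 * v * expect p (\<lambda>x. of_bool (x \<in> B)) + (1 / (12 * v)) * (3 * v\<^sup>2)"
    using m4 v by (intro add_left_mono mult_left_mono) auto
  also have "(1 / (12 * v)) * (3 * v\<^sup>2) = v / 4" using v by (simp add: power2_eq_square)
  finally have "v * (1 / 24) \<le> v * expect p (\<lambda>x. of_bool (x \<in> B))" by simp
  then have "1 / 24 \<le> expect p (\<lambda>x. of_bool (x \<in> B))" using v(2) by (simp only: mult_le_cancel_left_pos)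
  also have "\<dots> = (\<Sum>x\<in>B. pmf p x)"
    using measure_measure_pmf_finite[OF B(1), of p] prob_eq_expect[of p "\<lambda>x. x \<in> B"] by simp
  also have "\<dots> \<le> (\<Sum>x\<in>B. pmf p d)"
    using p(1) d unfolding unimodal_def by (intro sum_mono) (auto simp: B_def)
  also have "\<dots> \<le> 2 * R * pmf p d"
    using B(2) by (auto intro: mult_right_mono)
  finally have 1: "1 / 24 \<le> 2 * R * pmf p d" .
  \<comment> \<open>Replacing \<open>R\<close> by \<open>4 sqrt v\<close> gives the factor 24 * 2 *
    4 = 192, rounded up to 200.\<close>
  have "R \<le> sqrt (16 * v)" unfolding R_def using v by (intro real_sqrt_le_mono) auto
  then have "R \<le> 4 * sqrt v" by (simp add: real_sqrt_mult)
  then have "2 * R * pmf p d \<le> 2 * (4 * sqrt v) * pmf p d" by (intro mult_right_mono mult_left_mono) auto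
  with 1 have "1 \<le> 200 * sqrt v * pmf p d" by simp
  then show ?thesis using v by (simp add: field_simps)
qed

text \<open>At time \<open>T\<close> both kinds of walk have made all their \<open>m\<close> moves,
  so the size is uniform on \<open>{..T}\<close>; both signs lead to 0, which doubles its
  mass.\<close>

lemma pmf_jump_pmf:
  "pmf (jump_pmf T) d = (if \<bar>d\<bar> \<le> int T then (if d = 0 then 1 else 1/2) / (real T + 1) else 0)"
proof -
  let ?W = "UNIV \<times> UNIV \<times> {..T} :: (bool \<times> bool \<times> nat) set"
  have f: "walk_pos T T w = (case w of (s, b, m) \<Rightarrow> if s then int m else - int m)" if "w \<in> ?W" for w
    using that by (cases w) (auto simp: min_def)
  have eq: "{w \<in> ?W. walk_pos T T w = d} = {w \<in> ?W. (case w of (s, b, m) \<Rightarrow> if s then int m else - int m) = d}"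
    by (rule Collect_cong) (use f in auto)
  have 0: "{w \<in> ?W. walk_pos T T w = d} = UNIV \<times> UNIV \<times> {0}" if "d = 0"
    unfolding eq using that by (auto split: if_splits)
  have 1: "{w \<in> ?W. walk_pos T T w = d} = {d > 0} \<times> UNIV \<times> {nat \<bar>d\<bar>}" if "d \<noteq> 0" "\<bar>d\<bar> \<le> int T"
    unfolding eq using that by (auto split: if_splits)
  have 2: "{w \<in> ?W. walk_pos T T w = d} = {}" if "\<bar>d\<bar> > int T"
    unfolding eq using that by (auto split: if_splits)
  show ?thesis
    unfolding jump_pmf_def pmf_map_walk_pmf
    using 0 1 2 by (cases "\<bar>d\<bar> \<le> int T"; cases "d = 0")
      (auto simp: card_cartesian_product divide_simps simp del: walk_pos.simps)
qed

lemma unimodal_jump_pmf: "unimodal (jump_pmf T)"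
  unfolding unimodal_def pmf_jump_pmf by (auto simp: divide_simps)

text \<open>The lower bound, from the exact value \<open>T (2 T + 1) / 6\<close>, is strong enough
  to give fourth moment at most 3 times the squared second moment.\<close>

lemma moments_jump_pmf:
  shows "real T ^ 2 / 3 \<le> moment 2 (jump_pmf T)" "moment 2 (jump_pmf T) \<le> real T ^ 2"
    "moment 4 (jump_pmf T) \<le> real T ^ 2 * moment 2 (jump_pmf T)"
proof -
  have bound: "real_of_int x ^ 2 \<le> real T ^ 2" if "x \<in> set_pmf (jump_pmf T)" for x
  proof -
    have "\<bar>x\<bar> \<le> int T" using that by (auto simp: set_pmf_eq pmf_jump_pmf split: if_splits)
    then have "\<bar>real_of_int x\<bar> ^ 2 \<le> real T ^ 2" by (intro power_mono) linarith+
    then show ?thesis by simp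
  qed
  show "moment 2 (jump_pmf T) \<le> real T ^ 2"
    using expect_mono[OF finite_set_jump_pmf, of T "\<lambda>x. real_of_int x ^ 2" "\<lambda>_. real T ^ 2"] bound
    by (simp add: moment_def)
  have "moment 4 (jump_pmf T) \<le> expect (jump_pmf T) (\<lambda>x. real T ^ 2 * real_of_int x ^ 2)"
    unfolding moment_def
  proof (rule expect_mono[OF finite_set_jump_pmf])
    fix x assume "x \<in> set_pmf (jump_pmf T)"
    have "real_of_int x ^ 4 = real_of_int x ^ 2 * real_of_int x ^ 2" by (simp flip: power_add)
    also have "\<dots> \<le> real T ^ 2 * real_of_int x ^ 2"
      using bound[OF \<open>x \<in> _\<close>] by (intro mult_right_mono) auto
    finally show "real_of_int x ^ 4 \<le> real T ^ 2 * real_of_int x ^ 2" .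
  qed
  then show "moment 4 (jump_pmf T) \<le> real T ^ 2 * moment 2 (jump_pmf T)"
    by (simp add: moment_def)
  have sum2: "(\<Sum>m\<le>k. real m ^ 2) = real k * (real k + 1) * (2 * real k + 1) / 6" for k :: nat
    by (induction k) (simp_all add: field_simps power2_eq_square)
  have "(\<Sum>x\<in>{-int T..int T}. real_of_int x ^ 2 * pmf (jump_pmf T) x) = moment 2 (jump_pmf T)"
    unfolding moment_def
    by (rule integral_measure_pmf_real[symmetric]) (auto simp: set_pmf_eq pmf_jump_pmf split: if_splits)
  moreover have "(\<Sum>x\<in>{-int T..int T}. real_of_int x ^ 2 * pmf (jump_pmf T) x)
     = (\<Sum>x\<in>{-int T..-1} \<union> {0..int T}. real_of_int x ^ 2 / (2 * (real T + 1)))"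
    by (rule sum.cong) (auto simp: pmf_jump_pmf)
  moreover have "\<dots> = (\<Sum>x\<in>{-int T..-1}. real_of_int x ^ 2 / (2 * (real T + 1)))
      + (\<Sum>x\<in>{0..int T}. real_of_int x ^ 2 / (2 * (real T + 1)))"
    by (rule sum.union_disjoint) auto
  moreover have "(\<Sum>x\<in>{0..int T}. real_of_int x ^ 2 / (2 * (real T + 1)))
      = (\<Sum>m\<le>T. real m ^ 2 / (2 * (real T + 1)))"
    by (rule sum.reindex_bij_witness[of _ int nat]) auto
  moreover have "(\<Sum>x\<in>{-int T..-1}. real_of_int x ^ 2 / (2 * (real T + 1)))
      = (\<Sum>m\<in>{1..T}. real m ^ 2 / (2 * (real T + 1)))"
    by (rule sum.reindex_bij_witness[of _ "\<lambda>m. - int m" "\<lambda>x. nat (- x)"]) auto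
  moreover have "\<dots> = (\<Sum>m\<le>T. real m ^ 2 / (2 * (real T + 1)))"
    by (rule sum.mono_neutral_left) (auto simp: not_le)
  moreover have "(\<Sum>m\<le>T. real m ^ 2 / (2 * (real T + 1))) = real T * (2 * real T + 1) / 12"
    unfolding sum_divide_distrib[symmetric] sum2 by (simp add: field_simps)
  ultimately have "moment 2 (jump_pmf T) = real T * (2 * real T + 1) / 6" by simp
  then show "real T ^ 2 / 3 \<le> moment 2 (jump_pmf T)" by (simp add: power2_eq_square algebra_simps)
qed

text \<open>By symmetry of the jumps this is the law of a sum of \<open>2 ^ r\<close> independent
  jumps.\<close>

definition spread_pmf :: "nat \<Rightarrow> nat \<Rightarrow> int pmf" where
  "spread_pmf T r = (diff_pmf ^^ r) (jump_pmf T)"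

text \<open>The constant 3 is the Gaussian one and is stable under differences: with moments
  \<open>m2\<close>, \<open>m4\<close> one has
  \<open>2 m4 + 6 m2^2 \<le> 12 m2^2 = 3 (2 m2)^2\<close>.\<close>

lemma spread_pmf_invariants:
  "finite (set_pmf (spread_pmf T r))" "unimodal (spread_pmf T r)"
  "moment 2 (spread_pmf T r) = 2 ^ r * moment 2 (jump_pmf T)"
  "moment 4 (spread_pmf T r) \<le> 3 * (moment 2 (spread_pmf T r))\<^sup>2"
proof -
  let ?I = "\<lambda>r. finite (set_pmf (spread_pmf T r)) \<and> unimodal (spread_pmf T r) \<and>
    moment 2 (spread_pmf T r) = 2 ^ r * moment 2 (jump_pmf T) \<and>
    moment 4 (spread_pmf T r) \<le> 3 * (moment 2 (spread_pmf T r))\<^sup>2"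
  have "?I r"
  proof (induction r)
    case 0
    have "real T ^ 2 \<le> 3 * moment 2 (jump_pmf T)" using moments_jump_pmf(1)[of T] by simp
    moreover have "0 \<le> moment 2 (jump_pmf T)" by (simp add: moment_def expect_nonneg)
    ultimately have "real T ^ 2 * moment 2 (jump_pmf T) \<le> 3 * moment 2 (jump_pmf T) * moment 2 (jump_pmf T)"
      by (rule mult_right_mono)
    then show ?case
      using finite_set_jump_pmf unimodal_jump_pmf moments_jump_pmf(3)[of T]
      by (simp add: spread_pmf_def power2_eq_square)
  next
    case (Suc r)
    let ?p = "spread_pmf T r"
    have p: "spread_pmf T (Suc r) = diff_pmf ?p" by (simp add: spread_pmf_def)
    have fin: "finite (set_pmf ?p)" and m1: "moment 1 ?p = 0" using Suc moment_1_unimodal by auto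
    show ?case
      unfolding p moments_diff_pmf[OF fin m1] using Suc
      by (auto simp: power_mult_distrib intro!: finite_set_diff_pmf unimodal_diff_pmf)
  qed
  then show "finite (set_pmf (spread_pmf T r))" "unimodal (spread_pmf T r)"
    "moment 2 (spread_pmf T r) = 2 ^ r * moment 2 (jump_pmf T)"
    "moment 4 (spread_pmf T r) \<le> 3 * (moment 2 (spread_pmf T r))\<^sup>2" by auto
qed

lemma spread_pmf_ge:
  assumes T: "T > 0" and d: "\<bar>real_of_int d\<bar> \<le> real T * sqrt (2 ^ r) / 4"
  shows "1 / (200 * (real T * sqrt (2 ^ r))) \<le> pmf (spread_pmf T r) d"
proof -
  let ?v = "moment 2 (spread_pmf T r)"
  have v: "2 ^ r * (real T ^ 2 / 3) \<le> ?v" "?v \<le> 2 ^ r * real T ^ 2"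
    using moments_jump_pmf(1,2)[of T] unfolding spread_pmf_invariants(3) by auto
  have v0: "0 < ?v" using v(1) T by (smt (verit) divide_pos_pos mult_pos_pos of_nat_0_less_iff zero_less_power)
  have up: "sqrt ?v \<le> real T * sqrt (2 ^ r)"
    using real_sqrt_le_mono[OF v(2)] by (simp add: real_sqrt_mult mult.commute)
  have "(real T * sqrt (2 ^ r) / 2)\<^sup>2 = 2 ^ r * (real T ^ 2 / 4)"
    by (simp add: power_mult_distrib power_divide)
  also have "\<dots> \<le> 2 ^ r * (real T ^ 2 / 3)" by (intro mult_left_mono divide_left_mono) auto
  also have "\<dots> \<le> ?v" by (rule v(1))
  finally have "real T * sqrt (2 ^ r) / 2 \<le> sqrt ?v" by (rule real_le_rsqrt)
  moreover have "\<bar>real_of_int d\<bar> * 2 \<le> real T * sqrt (2 ^ r) / 2" using d by simp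
  ultimately have "\<bar>real_of_int d\<bar> \<le> sqrt ?v / 2" by linarith
  then have "1 / (200 * sqrt ?v) \<le> pmf (spread_pmf T r) d"
    using spread_pmf_invariants[of T r] v0 by (intro unimodal_pmf_ge) auto
  moreover have "1 / (200 * (real T * sqrt (2 ^ r))) \<le> 1 / (200 * sqrt ?v)"
    using up v0 T by (intro divide_left_mono) auto
  ultimately show ?thesis by linarith
qed

text \<open>Each use of \<open>agreement_square_le\<close> doubles the number of jumps and squares
  the bound.\<close>

lemma agreement_spread_ge:
  assumes n: "n > 0" and a: "periodic n t a"
  shows "agreement n t a a (jump_pmf T) ^ (2 ^ r) \<le> agreement n t a a (spread_pmf T r)"
proof (induction r)
  case (Suc r)
  have "0 \<le> agreement n t a a (jump_pmf T)" unfolding agreement_def by (intro expect_nonneg) auto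
  then have "(agreement n t a a (jump_pmf T) ^ (2 ^ r))\<^sup>2 \<le> (agreement n t a a (spread_pmf T r))\<^sup>2"
    using Suc by (intro power_mono) auto
  also have "\<dots> \<le> agreement n t a a (spread_pmf T (Suc r))"
    using agreement_square_le[OF n a a spread_pmf_invariants(1)[of T r]]
    by (simp add: spread_pmf_def diff_pmf_def)
  finally show ?case by (simp add: mult.commute flip: power_mult)
qed (simp add: spread_pmf_def)

section \<open>Exchanging points\<close>

text \<open>Displacements \<open>d\<close> and \<open>d - n\<close> of point 0 lead to the same
  configuration but have different parity, so at most one of them agrees. The \<open>n\<close>
  disjoint pairs inside the support cost at least
  \<open>n / (2 (2 n + 1)) \<ge> 1/6\<close>.\<close>

lemma agreement_jump_2n_le:
  assumes n: "odd n" and t: "t > 0" and a: "periodic n t a"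
  shows "agreement n t a a (jump_pmf (2 * n)) \<le> 5 / 6"
proof -
  let ?q = "jump_pmf (2 * n)" and ?I = "{1..<t}"
  let ?Q = "Pi_pmf ?I (0::int) (\<lambda>_. ?q)"
  have n0: "n > 0" using n odd_pos by blast
  have ins: "{..<t} = insert 0 ?I" using t by auto
  have fin: "finite (set_pmf ?q)" "finite (set_pmf ?Q)" "finite (set_pmf (torus n t))"
    using n0 by (auto intro!: finite_set_Pi_pmf finite_set_torus finite_set_jump_pmf)
  have main: "expect ?q (\<lambda>d. of_bool (agree t a a X (g(0 := d)))) \<le> 5 / 6" for X g
  proof -
    define h where "h = (\<lambda>d. of_bool (\<not> agree t a a X (g(0 := d))) :: real)"
    have h: "1 \<le> h d + h (d - int n)" for d
    proof -
      have "a (\<lambda>i. X i + (g(0 := d)) i) = a (\<lambda>i. X i + (g(0 := d - int n)) i)"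
        by (rule periodicD[OF a]) (auto simp: mod_eq_dvd_iff)
      then have "odd d = odd (d - int n)"
        if "agree t a a X (g(0 := d))" "agree t a a X (g(0 := d - int n))"
        using that t unfolding agree_def by (auto dest!: spec[of _ 0])
      then have "\<not> (agree t a a X (g(0 := d)) \<and> agree t a a X (g(0 := d - int n)))"
        using n by auto
      then show ?thesis by (auto simp: h_def)
    qed
    have h0: "0 \<le> h d" for d by (simp add: h_def)
    let ?c = "1 / (2 * (2 * real n + 1))"
    have "?c * real n = ?c * (\<Sum>d\<in>{1..int n}. 1)" by simp
    also have "\<dots> \<le> ?c * (\<Sum>d\<in>{1..int n}. h d + h (d - int n))"
      by (intro mult_left_mono sum_mono h) auto
    also have "\<dots> = ((\<Sum>d\<in>{1 - int n..0}. h d) + (\<Sum>d\<in>{1..int n}. h d)) * ?c"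
    proof -
      have "(\<Sum>d\<in>{1..int n}. h (d - int n)) = (\<Sum>d\<in>{1 - int n..0}. h d)"
        by (rule sum.reindex_bij_witness[of _ "\<lambda>d. d + int n" "\<lambda>d. d - int n"]) auto
      then show ?thesis by (simp only: sum.distrib mult.commute add.commute)
    qed
    also have "\<dots> = (\<Sum>d\<in>{1 - int n..0} \<union> {1..int n}. h d * ?c)"
      by (subst sum.union_disjoint) (auto simp: sum_distrib_right distrib_right simp del: times_divide_eq_left times_divide_eq_right)
    also have "\<dots> \<le> (\<Sum>d\<in>{1 - int n..0} \<union> {1..int n}. h d * pmf ?q d)"
      by (intro sum_mono mult_left_mono h0) (auto simp: pmf_jump_pmf divide_simps)
    also have "\<dots> \<le> (\<Sum>d\<in>{- int (2 * n)..int (2 * n)}. h d * pmf ?q d)"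
      by (intro sum_mono2) (auto simp: h0)
    also have "\<dots> = expect ?q h"
      by (rule integral_measure_pmf_real[symmetric]) (auto simp: set_pmf_eq pmf_jump_pmf split: if_splits)
    finally have "?c * real n \<le> expect ?q h" .
    moreover have "1 / 6 \<le> ?c * real n" using n0 by (simp add: field_simps)
    ultimately show ?thesis unfolding h_def expect_not[OF fin(1)] by linarith
  qed
  have "agreement n t a a ?q = expect (torus n t) (\<lambda>X. expect ?Q (\<lambda>g. expect ?q (\<lambda>d. of_bool (agree t a a X (g(0 := d))))))"
  proof -
    have "finite (set_pmf (Pi_pmf {..<t} 0 (\<lambda>_. ?q)))"
      using fin(1) by (intro finite_set_Pi_pmf) auto
    then have "agreement n t a a ?q = expect (torus n t) (\<lambda>X. expect (Pi_pmf {..<t} 0 (\<lambda>_. ?q)) (\<lambda>D. of_bool (agree t a a X D)))"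
      unfolding agreement_def by (rule expect_swap[OF _ fin(3)])
    also have "\<dots> = expect (torus n t) (\<lambda>X. expect ?q (\<lambda>d. expect ?Q (\<lambda>g. of_bool (agree t a a X (g(0 := d))))))"
      unfolding ins by (subst expect_Pi_pmf_insert) (auto simp: fin)
    finally show ?thesis by (subst (asm) expect_swap[OF fin(1,2)])
  qed
  also have "\<dots> \<le> expect (torus n t) (\<lambda>X. expect ?Q (\<lambda>g. 5 / 6))"
    by (intro expect_mono fin main)
  finally show ?thesis by simp
qed

text \<open>
  The position modulo \<open>n\<close> together with this bit is a position modulo \<open>2n\<close>. Unlike the answer
  itself the bit is preserved along agreeing displacements; it flips under translation by \<open>n\<close>.
\<close>
definition lift_label :: "((nat \<Rightarrow> int) \<Rightarrow> nat \<Rightarrow> bool) \<Rightarrow> (nat \<Rightarrow> int) \<Rightarrow> nat \<Rightarrow> bool" where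
  "lift_label a X i \<longleftrightarrow> a X i \<noteq> odd (X i)"

definition equivariant :: "nat \<Rightarrow> ((nat \<Rightarrow> int) \<Rightarrow> nat \<Rightarrow> bool) \<Rightarrow> bool" where
  "equivariant t a \<longleftrightarrow> (\<forall>X i j k. i < t \<longrightarrow> j < t \<longrightarrow> k < t \<longrightarrow>
     a (X \<circ> Transposition.transpose i j) k = a X (Transposition.transpose i j k))"

lemma agree_iff_lift_label:
  "agree t a a X D \<longleftrightarrow> (\<forall>i<t. lift_label a (\<lambda>i. X i + D i) i = lift_label a X i)"
  unfolding agree_def lift_label_def by auto

lemma lift_label_transpose:
  assumes "equivariant t a" "i < t" "j < t" "k < t"
  shows "lift_label a (X \<circ> Transposition.transpose i j) k = lift_label a X (Transposition.transpose i j k)"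
  using assms unfolding equivariant_def lift_label_def by simp

text \<open>Here \<open>F c d\<close> is the success probability when the points at
  \<open>x\<close>, \<open>x'\<close> move by \<open>c\<close>, \<open>d\<close>. A pair of targets
  and its swap together fall short of \<open>2 B\<close> by at least \<open>B\<close>, so the
  average deficit over the \<open>W^2\<close> target pairs is at least \<open>B / 2\<close>; each
  pair has mass at least \<open>k0^2\<close>.\<close>

lemma expect_exchange_le:
  fixes F :: "int \<Rightarrow> int \<Rightarrow> real"
  assumes k: "finite (set_pmf k)" "\<And>d. \<bar>d\<bar> < int W \<Longrightarrow> k0 \<le> pmf k d" "0 \<le> k0"
    and x: "x \<in> {lo..<lo + int W}" "x' \<in> {lo..<lo + int W}"
    and F: "\<And>c d. F c d \<le> B"
    and ex: "\<And>y y'. y \<in> {lo..<lo + int W} \<Longrightarrow> y' \<in> {lo..<lo + int W} \<Longrightarrow>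
      F (y - x) (y' - x') + F (y' - x) (y - x') \<le> B"
  shows "expect k (\<lambda>c. expect k (F c)) \<le> (1 - (k0 * real W)\<^sup>2 / 2) * B"
proof -
  let ?J = "{lo..<lo + int W}" and ?S = "set_pmf k"
  define H where "H = (\<lambda>c d. B - F c d)"
  have H0: "0 \<le> H c d" for c d using F by (simp add: H_def)
  have sum1: "(\<Sum>c\<in>(\<lambda>y. y - x) ` ?J. pmf k c * G c) \<le> expect k G" if "\<And>c. 0 \<le> G c" for G x
  proof -
    have "(\<Sum>c\<in>(\<lambda>y. y - x) ` ?J. pmf k c * G c) \<le> (\<Sum>c\<in>(\<lambda>y. y - x) ` ?J \<union> ?S. pmf k c * G c)"
      using k(1) that by (intro sum_mono2) auto
    also have "\<dots> = expect k G"
      using k(1) by (subst integral_measure_pmf_real[where A = "(\<lambda>y. y - x) ` ?J \<union> ?S"]) (auto simp: mult.commute)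
    finally show ?thesis .
  qed
  have reidx: "(\<Sum>c\<in>(\<lambda>y. y - x) ` ?J. G c) = (\<Sum>y\<in>?J. G (y - x))" for G :: "int \<Rightarrow> real" and x
    by (subst sum.reindex) (auto simp: inj_on_def)
  have "k0\<^sup>2 * (\<Sum>y\<in>?J. \<Sum>y'\<in>?J. H (y - x) (y' - x'))
      = (\<Sum>y\<in>?J. k0 * (\<Sum>y'\<in>?J. k0 * H (y - x) (y' - x')))"
    by (simp add: sum_distrib_left power2_eq_square mult.assoc)
  also have "\<dots> \<le> (\<Sum>y\<in>?J. pmf k (y - x) * (\<Sum>y'\<in>?J. pmf k (y' - x') * H (y - x) (y' - x')))"
    using x by (intro sum_mono mult_mono k(2) sum_nonneg mult_nonneg_nonneg H0 k(3)) auto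
  also have "\<dots> = (\<Sum>c\<in>(\<lambda>y. y - x) ` ?J. pmf k c * (\<Sum>d\<in>(\<lambda>y. y - x') ` ?J. pmf k d * H c d))"
    by (simp only: reidx)
  also have "\<dots> \<le> (\<Sum>c\<in>(\<lambda>y. y - x) ` ?J. pmf k c * expect k (H c))"
    by (intro sum_mono mult_left_mono sum1 H0) auto
  also have "\<dots> \<le> expect k (\<lambda>c. expect k (H c))"
    by (intro sum1 expect_nonneg H0)
  also have "\<dots> = B - expect k (\<lambda>c. expect k (F c))"
    by (simp add: H_def expect_diff[OF k(1)])
  finally have 1: "k0\<^sup>2 * (\<Sum>y\<in>?J. \<Sum>y'\<in>?J. H (y - x) (y' - x')) \<le> B - expect k (\<lambda>c. expect k (F c))" .
  have "real W * real W * B = (\<Sum>y\<in>?J. \<Sum>y'\<in>?J. B)" by simp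
  also have "\<dots> \<le> (\<Sum>y\<in>?J. \<Sum>y'\<in>?J. H (y - x) (y' - x') + H (y' - x) (y - x'))"
  proof (intro sum_mono)
    fix y y' assume "y \<in> ?J" "y' \<in> ?J"
    from ex[OF this] show "B \<le> H (y - x) (y' - x') + H (y' - x) (y - x')"
      unfolding H_def by linarith
  qed
  also have "\<dots> = (\<Sum>y\<in>?J. \<Sum>y'\<in>?J. H (y - x) (y' - x')) + (\<Sum>y\<in>?J. \<Sum>y'\<in>?J. H (y' - x) (y - x'))"
    by (simp add: sum.distrib)
  also have "(\<Sum>y\<in>?J. \<Sum>y'\<in>?J. H (y' - x) (y - x')) = (\<Sum>y\<in>?J. \<Sum>y'\<in>?J. H (y - x) (y' - x'))"
    by (rule sum.swap)
  finally have "k0\<^sup>2 * (real W * real W * B) \<le> k0\<^sup>2 * (2 * (\<Sum>y\<in>?J. \<Sum>y'\<in>?J. H (y - x) (y' - x')))"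
    by (intro mult_left_mono) auto
  with 1 show ?thesis by (simp add: algebra_simps power2_eq_square)
qed

text \<open>
  Exchanging the new positions of \<open>i\<close> and \<open>j\<close> exchanges their labels and leaves all other labels
  unchanged. As the prescribed labels differ, at most one of the two configurations succeeds.
\<close>
lemma label_preservation_le:
  assumes a: "equivariant t a"
    and k: "finite (set_pmf k)" "\<And>d. \<bar>d\<bar> < int W \<Longrightarrow> k0 \<le> pmf k d" "0 \<le> k0" "k0 * real W \<le> 1"
    and "finite C" "C \<subseteq> {..<t}"
    and "distinct (map fst ps @ map snd ps)"
    and "set (map fst ps @ map snd ps) \<subseteq> C"
    and "\<And>i j. (i, j) \<in> set ps \<Longrightarrow> Z i \<in> {lo..<lo + int W} \<and> Z j \<in> {lo..<lo + int W} \<and> \<beta> i \<noteq> \<beta> j"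
  shows "expect (Pi_pmf C 0 (\<lambda>_. k)) (\<lambda>D. of_bool (\<forall>(i, j)\<in>set ps.
      lift_label a (\<lambda>l. Z l + D l) i = \<beta> i \<and> lift_label a (\<lambda>l. Z l + D l) j = \<beta> j))
    \<le> (1 - (k0 * real W)\<^sup>2 / 2) ^ length ps"
  using assms(6-)
proof (induction ps arbitrary: C Z)
  case (Cons p ps)
  obtain i j where p: "p = (i, j)" by force
  define C' where "C' = C - {i, j}"
  let ?J = "{lo..<lo + int W}"
  let ?P = "Pi_pmf C' (0::int) (\<lambda>_. k)"
  let ?B = "(1 - (k0 * real W)\<^sup>2 / 2) ^ length ps"
  define E where "E = (\<lambda>ps Y. \<forall>(i, j)\<in>set ps. lift_label a Y i = \<beta> i \<and> lift_label a Y j = \<beta> j)"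
  define Y where "Y = (\<lambda>c d D l. (Z(i := Z i + c, j := Z j + d)) l + D l :: int)"
  have ij: "i \<noteq> j" "i \<in> C" "j \<in> C" "i < t" "j < t" using Cons.prems by (auto simp: p)
  have C: "C = insert i (insert j C')" "finite C'" "i \<notin> insert j C'" "j \<notin> C'"
    using ij Cons.prems(1) by (auto simp: C'_def)
  have fin: "finite (set_pmf ?P)" using k(1) C(2) by (intro finite_set_Pi_pmf) auto
  \<comment> \<open>\<open>D\<close> takes its default 0 at \<open>i\<close> and \<open>j\<close>,
    so \<open>Y c d D\<close> may add it everywhere.\<close>
  have zero: "D i = 0" "D j = 0" if "D \<in> set_pmf ?P" for D
    using that set_Pi_pmf_subset[OF C(2), of 0 "\<lambda>_. k"] by (auto simp: C'_def)
  have other: "u \<in> C'" "v \<in> C'" if "(u, v) \<in> set ps" for u v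
  proof -
    have "u \<in> set (map fst ps)" "v \<in> set (map snd ps)" using that by force+
    then show "u \<in> C'" "v \<in> C'" using Cons.prems(3,4) unfolding C'_def p by auto
  qed
  define F where "F = (\<lambda>c d. expect ?P (\<lambda>D. of_bool (E ((i, j) # ps) (Y c d D))))"
  \<comment> \<open>Fixing the new positions of \<open>i\<close> and \<open>j\<close> changes the
    base configuration only outside the remaining pairs.\<close>
  have IH: "expect ?P (\<lambda>D. of_bool (E ps (Y c d D))) \<le> ?B" for c d
    unfolding E_def Y_def
  proof (rule Cons.IH)
    show "finite C'" "C' \<subseteq> {..<t}" using C(2) Cons.prems(2) by (auto simp: C'_def)
    show "distinct (map fst ps @ map snd ps)" using Cons.prems(3) by (simp add: p)
    show "set (map fst ps @ map snd ps) \<subseteq> C'"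
      using Cons.prems(3,4) by (auto simp: p C'_def)
    fix u v assume uv: "(u, v) \<in> set ps"
    then show "(Z(i := Z i + c, j := Z j + d)) u \<in> ?J \<and> (Z(i := Z i + c, j := Z j + d)) v \<in> ?J \<and> \<beta> u \<noteq> \<beta> v"
      using Cons.prems(5)[of u v] other[OF uv] by (auto simp: C'_def)
  qed
  have "expect (Pi_pmf C 0 (\<lambda>_. k)) (\<lambda>D. of_bool (E (p # ps) (\<lambda>l. Z l + D l)))
      = expect k (\<lambda>c. expect k (\<lambda>d. expect ?P (\<lambda>D. of_bool (E (p # ps) (\<lambda>l. Z l + (D(j := d, i := c)) l)))))"
    unfolding C(1) by (simp only: expect_Pi_pmf_insert[OF _ C(3) k(1)] expect_Pi_pmf_insert[OF C(2,4) k(1)] finite_insert C(2))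
  also have "\<dots> = expect k (\<lambda>c. expect k (F c))"
    unfolding F_def p
  proof (intro expect_cong arg_cong[of _ _ of_bool] arg_cong[of _ _ "E ((i, j) # ps)"] ext)
    fix c d D l assume "D \<in> set_pmf ?P"
    then show "Z l + (D(j := d, i := c)) l = Y c d D l" using zero[of D] ij by (auto simp: Y_def)
  qed
  also have "\<dots> \<le> (1 - (k0 * real W)\<^sup>2 / 2) * ?B"
  proof (rule expect_exchange_le[OF k(1,2,3)])
    show "Z i \<in> ?J" "Z j \<in> ?J" using Cons.prems(5)[of i j] by (auto simp: p)
    show "F c d \<le> ?B" for c d
      by (rule order_trans[OF _ IH[of c d]], unfold F_def, rule expect_mono[OF fin]) (auto simp: E_def)
    fix y y'
    let ?Y1 = "Y (y - Z i) (y' - Z j)" and ?Y2 = "Y (y' - Z i) (y - Z j)"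
    have "F (y - Z i) (y' - Z j) + F (y' - Z i) (y - Z j)
      = expect ?P (\<lambda>D. of_bool (E ((i, j) # ps) (?Y1 D)) + of_bool (E ((i, j) # ps) (?Y2 D)))"
      unfolding F_def by (simp add: expect_add[OF fin])
    also have "\<dots> \<le> expect ?P (\<lambda>D. of_bool (E ps (?Y1 D)))"
    proof (rule expect_mono[OF fin])
      fix D assume D: "D \<in> set_pmf ?P"
      have "?Y2 D = ?Y1 D \<circ> Transposition.transpose i j"
        using zero[OF D] ij by (auto simp: Y_def fun_eq_iff Transposition.transpose_def)
      then have tr: "lift_label a (?Y2 D) u = lift_label a (?Y1 D) (Transposition.transpose i j u)" if "u < t" for u
        using lift_label_transpose[OF a ij(4,5) that, of "?Y1 D"] by simp
      have "\<not> (E ((i, j) # ps) (?Y1 D) \<and> E ((i, j) # ps) (?Y2 D))"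
        using tr[OF ij(4)] Cons.prems(5)[of i j] by (auto simp: E_def p)
      moreover have "E ps (?Y1 D)" if "E ((i, j) # ps) (?Y2 D)"
        unfolding E_def
      proof (rule ballI)
        fix q assume "q \<in> set ps"
        then obtain u v where uv: "(u, v) \<in> set ps" "q = (u, v)" by (metis surj_pair)
        have "u < t" "v < t" "Transposition.transpose i j u = u" "Transposition.transpose i j v = v"
          using other[OF uv(1)] Cons.prems(2) by (auto simp: C'_def Transposition.transpose_def)
        then show "case q of (u, v) \<Rightarrow> lift_label a (?Y1 D) u = \<beta> u \<and> lift_label a (?Y1 D) v = \<beta> v"
          using that uv tr[of u] tr[of v] unfolding E_def by auto
      qed
      moreover have "E ps (?Y1 D)" if "E ((i, j) # ps) (?Y1 D)"
        using that by (auto simp: E_def)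
      ultimately show "of_bool (E ((i, j) # ps) (?Y1 D)) + of_bool (E ((i, j) # ps) (?Y2 D))
          \<le> (of_bool (E ps (?Y1 D)) :: real)" by auto
    qed
    also have "\<dots> \<le> ?B" by (rule IH)
    finally show "F (y - Z i) (y' - Z j) + F (y' - Z i) (y - Z j) \<le> ?B" .
  qed
  finally show ?case by (simp add: E_def)
qed simp

section \<open>Cells and majority labels\<close>

definition cell :: "nat \<Rightarrow> nat \<Rightarrow> (nat \<Rightarrow> int) \<Rightarrow> nat \<Rightarrow> nat set" where
  "cell t l X j = {i. i < t \<and> X i div int l = int j}"

lemma finite_cell: "finite (cell t l X j)"
  unfolding cell_def by simp

lemma div_int_eq_iff:
  fixes x :: int
  assumes "l > 0"
  shows "x div int l = int j \<longleftrightarrow> int (j * l) \<le> x \<and> x < int (j * l) + int l"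
proof
  assume "x div int l = int j"
  then have "x = int j * int l + x mod int l" using div_mult_mod_eq[of x "int l"] by simp
  moreover have "0 \<le> x mod int l" "x mod int l < int l" using assms by simp_all
  ultimately show "int (j * l) \<le> x \<and> x < int (j * l) + int l" by simp
next
  assume "int (j * l) \<le> x \<and> x < int (j * l) + int l"
  then show "x div int l = int j"
    by (intro int_div_pos_eq[of _ _ _ "x - int j * int l"]) (auto simp: algebra_simps)
qed

lemma in_cell:
  "l > 0 \<Longrightarrow> i \<in> cell t l X j \<longleftrightarrow> i < t \<and> int (j * l) \<le> X i \<and> X i < int (j * l) + int l"
  by (simp add: cell_def div_int_eq_iff)

text \<open>
  If the majority label does not change between consecutive cells, it must change where the cycle
  closes, because going around a cycle of odd length flips the parity of the positions.
\<close>
lemma ex_mixed_arc: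
  assumes n: "odd n" and a: "periodic n t a" and l: "l > 0" and M: "M = n div l" "M \<ge> 2"
    and X: "\<And>j. j < M \<Longrightarrow> 2 * s \<le> card (cell t l X j)"
  obtains Z lo G0 G1 where
    "\<And>i. i < t \<Longrightarrow> Z i mod int n = X i mod int n"
    "G0 \<subseteq> {..<t}" "G1 \<subseteq> {..<t}" "s \<le> card G0" "s \<le> card G1"
    "\<And>i. i \<in> G0 \<union> G1 \<Longrightarrow> Z i \<in> {lo..<lo + int (3 * l)}"
    "\<And>i. i \<in> G0 \<Longrightarrow> \<not> lift_label a Z i" "\<And>i. i \<in> G1 \<Longrightarrow> lift_label a Z i"
proof -
  define T where "T = (\<lambda>j. {i \<in> cell t l X j. lift_label a X i})"
  define F where "F = (\<lambda>j. {i \<in> cell t l X j. \<not> lift_label a X i})"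
  \<comment> \<open>A threshold rather than a strict majority: among \<open>2 s\<close> points, one
    of the two labels occurs at least \<open>s\<close> times.\<close>
  define maj where "maj = (\<lambda>j. s \<le> card (T j))"
  have fin: "finite (T j)" "finite (F j)" for j using finite_cell by (auto simp: T_def F_def)
  have F: "s \<le> card (F j)" if "\<not> maj j" "j < M" for j
  proof -
    have "card (cell t l X j) = card (T j \<union> F j)" by (rule arg_cong[of _ _ card]) (auto simp: T_def F_def)
    also have "\<dots> = card (T j) + card (F j)" using fin by (intro card_Un_disjoint) (auto simp: T_def F_def)
    finally show ?thesis using X[OF that(2)] that(1) by (simp add: maj_def)
  qed
  show ?thesis
  proof (cases "\<exists>j. Suc j < M \<and> maj j \<noteq> maj (Suc j)")
    case True
    then obtain j where j: "Suc j < M" "maj j \<noteq> maj (Suc j)" by blast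
    define j0 where "j0 = (if maj j then Suc j else j)"
    define j1 where "j1 = (if maj j then j else Suc j)"
    show ?thesis
    proof (rule that[of X "F j0" "T j1" "int (j * l)"])
      show "s \<le> card (F j0)" "s \<le> card (T j1)"
        using F[of j0] j by (auto simp: j0_def j1_def maj_def)
      fix i assume i: "i \<in> F j0 \<union> T j1"
      then have "i \<in> cell t l X j \<or> i \<in> cell t l X (Suc j)"
        by (auto simp: F_def T_def j0_def j1_def split: if_splits)
      then show "X i \<in> {int (j * l)..<int (j * l) + int (3 * l)}"
        using l by (auto simp: in_cell)
    qed (auto simp: F_def T_def cell_def)
  next
    case False
    have maj0: "maj j = maj 0" if "j < M" for j
      using that False by (induction j) auto
    \<comment> \<open>Moving cell 0 past the end of the cycle keeps all answers but flips its
      labels, since \<open>n\<close> is odd.\<close>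
    define Z where "Z = (\<lambda>i. if i \<in> cell t l X 0 then X i + int n else X i)"
    obtain m where m: "M = Suc m" using M(2) by (cases M) auto
    have Z: "Z i mod int n = X i mod int n" for i by (simp add: Z_def)
    have "a Z = a X" by (rule periodicD[OF a]) (rule Z)
    then have lab: "lift_label a Z i = (lift_label a X i \<noteq> (i \<in> cell t l X 0))" for i
      using n by (auto simp: lift_label_def Z_def)
    have disj: "i \<notin> cell t l X 0" if "i \<in> cell t l X m" for i
      using that m M(2) by (auto simp: cell_def)
    \<comment> \<open>Between the last cell and the shifted cell 0 lies a remainder shorter than
      \<open>l\<close>; this is the source of the arc length \<open>3 * l\<close>.\<close>
    have len: "int n < int (m * l) + 2 * int l" "int (m * l) + int l \<le> int n"
    proof -
      have "n < M * l + l" "M * l \<le> n"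
        using l unfolding M(1) by (metis add.commute dividend_less_div_times, simp)
      moreover have "M * l = m * l + l" using m by simp
      ultimately show "int n < int (m * l) + 2 * int l" "int (m * l) + int l \<le> int n" by linarith+
    qed
    have arc: "Z i \<in> {int (m * l)..<int (m * l) + int (3 * l)}"
      if "i \<in> cell t l X 0 \<union> cell t l X m" for i
      using that disj[of i] l len by (auto simp: Z_def in_cell)
    have "maj m = maj 0" by (rule maj0) (simp add: m)
    show ?thesis
    proof (cases "maj 0")
      case True
      show ?thesis
      proof (rule that[of Z "T 0" "T m" "int (m * l)"])
        show "s \<le> card (T 0)" "s \<le> card (T m)" using True \<open>maj m = maj 0\<close> by (auto simp: maj_def)
      qed (use Z arc lab disj in \<open>auto simp: T_def cell_def\<close>)
    next
      case 0: False
      show ?thesis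
      proof (rule that[of Z "F m" "F 0" "int (m * l)"])
        show "s \<le> card (F 0)" "s \<le> card (F m)" using 0 \<open>maj m = maj 0\<close> m by (auto intro!: F)
      qed (use Z arc lab disj in \<open>auto simp: F_def cell_def\<close>)
    qed
  qed
qed

text \<open>Agreement preserves all labels, in particular those of \<open>s\<close> disjoint pairs
  matching the two label classes in the arc. It depends on residues only, so \<open>X\<close> may be
  replaced by \<open>Z\<close>.\<close>

lemma mixed_arc_agreement_le:
  assumes n: "odd n" and a: "periodic n t a" "equivariant t a" and l: "l > 0" and M: "M = n div l" "M \<ge> 2"
    and X: "\<And>j. j < M \<Longrightarrow> 2 * s \<le> card (cell t l X j)"
    and k: "finite (set_pmf k)" "\<And>d. \<bar>d\<bar> < int (3 * l) \<Longrightarrow> k0 \<le> pmf k d" "0 \<le> k0" "k0 * real (3 * l) \<le> 1"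
  shows "expect (Pi_pmf {..<t} 0 (\<lambda>_. k)) (\<lambda>D. of_bool (agree t a a X D)) \<le> (1 - (k0 * real (3 * l))\<^sup>2 / 2) ^ s"
proof -
  obtain Z lo G0 G1 where Z: "\<And>i. i < t \<Longrightarrow> Z i mod int n = X i mod int n"
    and G: "G0 \<subseteq> {..<t}" "G1 \<subseteq> {..<t}" "s \<le> card G0" "s \<le> card G1"
    and arc: "\<And>i. i \<in> G0 \<union> G1 \<Longrightarrow> Z i \<in> {lo..<lo + int (3 * l)}"
    and lab: "\<And>i. i \<in> G0 \<Longrightarrow> \<not> lift_label a Z i" "\<And>i. i \<in> G1 \<Longrightarrow> lift_label a Z i"
    by (rule ex_mixed_arc[OF n a(1) l M X]) auto
  obtain xs ys where xs: "set xs \<subseteq> G0" "distinct xs" "length xs = s"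
    and ys: "set ys \<subseteq> G1" "distinct ys" "length ys = s"
    by (metis G(3,4) obtain_subset_with_card_n finite_distinct_list distinct_card)
  define ps where "ps = zip xs ys"
  have ps: "map fst ps = xs" "map snd ps = ys" "length ps = s" using xs ys by (auto simp: ps_def)
  have mem: "i \<in> G0 \<and> j \<in> G1" if "(i, j) \<in> set ps" for i j
    using that xs(1) ys(1) unfolding ps_def by (auto dest: set_zip_leftD set_zip_rightD)
  have fin: "finite (set_pmf (Pi_pmf {..<t} 0 (\<lambda>_. k)))" using k(1) by (intro finite_set_Pi_pmf) auto
  have "expect (Pi_pmf {..<t} 0 (\<lambda>_. k)) (\<lambda>D. of_bool (agree t a a X D))
      \<le> expect (Pi_pmf {..<t} 0 (\<lambda>_. k)) (\<lambda>D. of_bool (\<forall>(i, j)\<in>set ps.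
        lift_label a (\<lambda>l. Z l + D l) i = lift_label a Z i \<and> lift_label a (\<lambda>l. Z l + D l) j = lift_label a Z j))"
  proof (rule expect_mono[OF fin])
    fix D
    have "agree t a a X D = agree t a a Z D"
      by (rule periodicD[OF periodic_agree[OF a(1) a(1)]]) (simp add: Z)
    then show "of_bool (agree t a a X D) \<le> (of_bool (\<forall>(i, j)\<in>set ps.
        lift_label a (\<lambda>l. Z l + D l) i = lift_label a Z i \<and> lift_label a (\<lambda>l. Z l + D l) j = lift_label a Z j) :: real)"
      using mem G(1,2) by (auto simp: agree_iff_lift_label subset_iff)
  qed
  also have "\<dots> \<le> (1 - (k0 * real (3 * l))\<^sup>2 / 2) ^ length ps"
  proof (rule label_preservation_le[OF a(2) k])
    show "distinct (map fst ps @ map snd ps)" "set (map fst ps @ map snd ps) \<subseteq> {..<t}"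
      using xs ys lab G(1,2) unfolding ps by auto
    show "Z i \<in> {lo..<lo + int (3 * l)} \<and> Z j \<in> {lo..<lo + int (3 * l)} \<and> lift_label a Z i \<noteq> lift_label a Z j"
      if "(i, j) \<in> set ps" for i j using mem[OF that] arc lab by auto
  qed auto
  finally show ?thesis by (simp add: ps)
qed

text \<open>A Chernoff bound: the indicator is at most \<open>4 ^ s\<close> times 2 to the minus
  number of points in the cell, and that weight factorises over the independent points.\<close>

lemma sparse_cell_prob_le:
  assumes l: "l > 0" and j: "j < n div l"
  shows "expect (torus n t) (\<lambda>X. of_bool (card (cell t l X j) < 2 * s)) \<le> 4 ^ s * (1 - real l / (2 * real n)) ^ t"
proof -
  have n: "n > 0" using j by (cases n) auto
  define w where "w = (\<lambda>x::int. if x div int l = int j then 1 / 2 else 1 :: real)"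
  have w: "(\<Prod>i<t. w (X i)) = (1 / 2) ^ card (cell t l X j)" for X
  proof -
    have "(\<Prod>i<t. w (X i)) = (\<Prod>i\<in>{i \<in> {..<t}. X i div int l = int j}. 1 / 2)"
      unfolding w_def by (subst prod.inter_filter) auto
    then show ?thesis by (simp add: cell_def)
  qed
  have "expect (torus n t) (\<lambda>X. of_bool (card (cell t l X j) < 2 * s)) \<le> expect (torus n t) (\<lambda>X. 4 ^ s * (\<Prod>i<t. w (X i)))"
  proof (rule expect_mono[OF finite_set_torus[OF n]])
    fix X
    show "of_bool (card (cell t l X j) < 2 * s) \<le> 4 ^ s * (\<Prod>i<t. w (X i))"
    proof (cases "card (cell t l X j) < 2 * s")
      case True
      then have "(1 / 2 :: real) ^ (2 * s) \<le> (1 / 2) ^ card (cell t l X j)"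
        by (intro power_decreasing) auto
      then have "4 ^ s * (1 / 2 :: real) ^ (2 * s) \<le> 4 ^ s * (1 / 2) ^ card (cell t l X j)" by simp
      moreover have "4 ^ s * (1 / 2 :: real) ^ (2 * s) = 1"
        by (simp add: power_mult power_one_over)
      ultimately show ?thesis using True by (simp add: w)
    qed (simp add: w)
  qed
  also have "\<dots> = 4 ^ s * expect (torus n t) (\<lambda>X. \<Prod>i<t. w (X i))" by simp
  also have "expect (torus n t) (\<lambda>X. \<Prod>i<t. w (X i)) = (\<Prod>i<t. expect (pmf_of_set {0..<int n}) w)"
    unfolding torus_def using n
    by (intro expectation_prod_Pi_pmf integrable_measure_pmf_finite) (auto simp: w_def)
  also have "expect (pmf_of_set {0..<int n}) w = 1 - real l / (2 * real n)"
  proof -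
    have eq: "{x \<in> {0..<int n}. x div int l = int j} = {int (j * l)..<int (j * l) + int l}"
    proof -
      have "(j + 1) * l \<le> n div l * l" using j by (intro mult_right_mono) auto
      also have "\<dots> \<le> n" by simp
      finally have "j * l + l \<le> n" by simp
      then have "int (j * l) + int l \<le> int n" by linarith
      moreover have "0 \<le> int (j * l)" by simp
      ultimately show ?thesis unfolding div_int_eq_iff[OF l] by (auto simp del: of_nat_mult)
    qed
    have "(\<Sum>x\<in>{0..<int n}. w x) = (\<Sum>x\<in>{0..<int n}. 1 - of_bool (x div int l = int j) / 2)"
      by (rule sum.cong) (auto simp: w_def)
    also have "\<dots> = real n - (\<Sum>x\<in>{0..<int n}. of_bool (x div int l = int j)) / 2"
      by (simp add: sum_subtractf flip: sum_divide_distrib)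
    also have "(\<Sum>x\<in>{0..<int n}. of_bool (x div int l = int j) :: real) = real (card {x \<in> {0..<int n}. x div int l = int j})"
      by (simp add: Int_def)
    also have "\<dots> = real l" unfolding eq by simp
    finally show ?thesis using n by (subst integral_pmf_of_set) (auto simp: field_simps)
  qed
  finally show ?thesis by simp
qed

text \<open>The first term is a union bound over the at most \<open>n / l\<close> cells being
  sparse; the second bounds agreement for every other \<open>X\<close>.\<close>

lemma agreement_le:
  assumes n: "odd n" and a: "periodic n t a" "equivariant t a" and l: "l > 0" "2 * l \<le> n"
    and k: "finite (set_pmf k)" "\<And>d. \<bar>d\<bar> < int (3 * l) \<Longrightarrow> k0 \<le> pmf k d" "0 \<le> k0" "k0 * real (3 * l) \<le> 1"
  shows "agreement n t a a k \<le> real n / real l * 4 ^ s * (1 - real l / (2 * real n)) ^ t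
    + (1 - (k0 * real (3 * l))\<^sup>2 / 2) ^ s"
proof -
  define M where "M = n div l"
  have M2: "M \<ge> 2" using l unfolding M_def by (simp add: less_eq_div_iff_mult_less_eq)
  have n0: "n > 0" using n odd_pos by blast
  let ?Q = "Pi_pmf {..<t} 0 (\<lambda>_. k)" and ?X = "torus n t"
  let ?\<beta> = "(1 - (k0 * real (3 * l))\<^sup>2 / 2) ^ s" and ?\<delta> = "4 ^ s * (1 - real l / (2 * real n)) ^ t"
  have fin: "finite (set_pmf ?Q)" "finite (set_pmf ?X)"
    using k(1) n0 by (auto intro!: finite_set_Pi_pmf finite_set_torus)
  have \<beta>0: "0 \<le> ?\<beta>"
  proof -
    have "(k0 * real (3 * l))\<^sup>2 \<le> 1" using k(3,4) by (intro power_le_one) auto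
    then show ?thesis by (intro zero_le_power) auto
  qed
  have \<delta>0: "0 \<le> ?\<delta>" using l n0 by (intro mult_nonneg_nonneg zero_le_power) (auto simp: field_simps)
  have "agreement n t a a k = expect ?X (\<lambda>X. expect ?Q (\<lambda>D. of_bool (agree t a a X D)))"
    unfolding agreement_def by (rule expect_swap[OF fin])
  also have "\<dots> \<le> expect ?X (\<lambda>X. (\<Sum>j<M. of_bool (card (cell t l X j) < 2 * s)) + ?\<beta>)"
  proof (rule expect_mono[OF fin(2)])
    fix X
    show "expect ?Q (\<lambda>D. of_bool (agree t a a X D)) \<le> (\<Sum>j<M. of_bool (card (cell t l X j) < 2 * s)) + ?\<beta>"
    proof (cases "\<forall>j<M. 2 * s \<le> card (cell t l X j)")
      case True
      then have "expect ?Q (\<lambda>D. of_bool (agree t a a X D)) \<le> ?\<beta>"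
        using M2 by (intro mixed_arc_agreement_le[OF n a l(1) M_def _ _ k]) auto
      then show ?thesis by (simp add: add_increasing sum_nonneg)
    next
      case False
      then obtain j where j: "j < M" "card (cell t l X j) < 2 * s" by (auto simp: not_le)
      have "expect ?Q (\<lambda>D. of_bool (agree t a a X D)) \<le> expect ?Q (\<lambda>D. 1)"
        by (rule expect_mono[OF fin(1)]) auto
      also have "\<dots> = of_bool (card (cell t l X j) < 2 * s)" using j by simp
      also have "\<dots> \<le> (\<Sum>j<M. of_bool (card (cell t l X j) < 2 * s))"
        using j(1) by (intro member_le_sum) auto
      finally show ?thesis using \<beta>0 by linarith
    qed
  qed
  also have "\<dots> = (\<Sum>j<M. expect ?X (\<lambda>X. of_bool (card (cell t l X j) < 2 * s))) + ?\<beta>"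
    by (subst expect_add[OF fin(2)], subst expect_sum_distrib[OF fin(2)]) simp
  also have "(\<Sum>j<M. expect ?X (\<lambda>X. of_bool (card (cell t l X j) < 2 * s))) \<le> (\<Sum>j<M. ?\<delta>)"
    using l(1) by (intro sum_mono sparse_cell_prob_le) (auto simp: M_def)
  also have "\<dots> = real M * ?\<delta>" by simp
  also have "\<dots> \<le> real n / real l * ?\<delta>"
  proof (intro mult_right_mono \<delta>0)
    have "M * l \<le> n" by (simp add: M_def)
    then have "real M * real l \<le> real n" by (metis of_nat_le_iff of_nat_mult)
    then show "real M \<le> real n / real l" using l(1) by (simp add: field_simps)
  qed
  finally show ?thesis by (simp add: mult.assoc)
qed

section \<open>Strategies as periodic equivariant functions\<close>

definition position_list :: "nat \<Rightarrow> nat \<Rightarrow> (nat \<Rightarrow> int) \<Rightarrow> nat list" where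
  "position_list n t X = map (\<lambda>i. nat (X i mod int n)) [0..<t]"

definition unroll :: "nat \<Rightarrow> nat \<Rightarrow> (nat list \<Rightarrow> bool list) \<Rightarrow> (nat \<Rightarrow> int) \<Rightarrow> nat \<Rightarrow> bool" where
  "unroll n t A X i = A (position_list n t X) ! i"

lemma periodic_unroll: "periodic n t (unroll n t A)"
  unfolding periodic_def
proof (intro allI impI)
  fix X Y :: "nat \<Rightarrow> int" assume "\<forall>i<t. X i mod int n = Y i mod int n"
  then have "position_list n t X = position_list n t Y" unfolding position_list_def by simp
  then show "unroll n t A X = unroll n t A Y" by (simp add: unroll_def fun_eq_iff)
qed

lemma equivariant_unroll:
  assumes n: "n > 0" and A: "A \<in> sym_strategies n t"
  shows "equivariant t (unroll n t A)"
  unfolding equivariant_def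
proof (intro allI impI)
  fix X i j k assume ij: "i < t" "j < t" and k: "k < t"
  let ?\<pi> = "Transposition.transpose i j" and ?x = "position_list n t X"
  have \<pi>: "?\<pi> permutes {..<t}" using ij by (intro permutes_swap_id) auto
  have x: "?x \<in> tuples t {..<n}" "length ?x = t"
    using n by (auto simp: tuples_def position_list_def nat_less_iff)
  have "position_list n t (X \<circ> ?\<pi>) = permute_list ?\<pi> ?x"
    using permutes_in_image[OF \<pi>] by (intro nth_equalityI) (auto simp: permute_list_nth position_list_def \<pi>)
  then have "A (position_list n t (X \<circ> ?\<pi>)) = permute_list ?\<pi> (A ?x)"
    using A x(1) \<pi> by (auto simp: sym_strategies_def)
  moreover have "length (A ?x) = t"
    using A x(1) by (auto simp: sym_strategies_def tuples_def dest!: PiE_mem)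
  ultimately show "unroll n t A (X \<circ> ?\<pi>) k = unroll n t A X (?\<pi> k)"
    using k by (simp add: unroll_def permute_list_nth \<pi>)
qed

lemma cycle_challenge_eq:
  assumes n: "n \<ge> 3"
  shows "cycle_challenge n = map_pmf (\<lambda>(u, e). (nat (u mod int n), nat ((u + e) mod int n)))
    (pair_pmf (pmf_of_set {0..<int n}) step_pmf)"
proof -
  let ?U = "pmf_of_set {0..<int n}"
  have U: "pmf_of_set {..<n} = map_pmf nat ?U"
  proof -
    have "nat ` {0..<int n} = {..<n}" by (auto simp: image_iff intro!: bexI[of _ "int _"])
    then show ?thesis using n by (subst map_pmf_of_set_inj) (auto simp: inj_on_def)
  qed
  have nb: "pmf_of_set (cycle_neighbours n (nat u)) = map_pmf (\<lambda>e. nat ((u + e) mod int n)) (pmf_of_set {-1, 1})"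
    if u: "u \<in> {0..<int n}" for u
  proof -
    have "nat ((u + 1) mod int n) = (nat u + 1) mod n"
      using u by (simp add: nat_mod_distrib nat_add_distrib)
    moreover have "nat ((u - 1) mod int n) = (nat u + n - 1) mod n"
    proof -
      have "(u - 1) mod int n = (u + int n - 1) mod int n"
        by (metis add_diff_eq diff_add_eq mod_add_self2)
      then show ?thesis using u n by (simp add: nat_mod_distrib nat_add_distrib nat_diff_distrib)
    qed
    ultimately have im: "(\<lambda>e. nat ((u + e) mod int n)) ` {-1, 1} = cycle_neighbours n (nat u)"
      by (auto simp: cycle_neighbours_def)
    \<comment> \<open>For \<open>n \<ge> 3\<close> the two neighbours differ, so a uniform neighbour
      is a uniform direction.\<close>
    have "inj_on (\<lambda>e. nat ((u + e) mod int n)) {-1, 1}"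
    proof -
      have "(u + 1) mod int n \<noteq> (u - 1) mod int n"
        using n by (auto simp: mod_eq_dvd_iff dest: zdvd_imp_le)
      then show ?thesis using n by (auto simp: inj_on_def eq_nat_nat_iff)
    qed
    from map_pmf_of_set_inj[OF this] show ?thesis unfolding im by simp
  qed
  have "cycle_challenge n = bind_pmf ?U (\<lambda>u. bind_pmf step_pmf
      (\<lambda>e. return_pmf (nat (u mod int n), nat ((u + e) mod int n))))"
    unfolding cycle_challenge_def U bind_map_pmf
  proof (intro bind_pmf_cong refl)
    fix u assume "u \<in> set_pmf ?U"
    then have u: "u \<in> {0..<int n}" using n by simp
    show "bernoulli_pmf (1 / 2) \<bind> (\<lambda>same. (if same then return_pmf (nat u)
          else pmf_of_set (cycle_neighbours n (nat u))) \<bind> (\<lambda>v. return_pmf (nat u, v)))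
      = step_pmf \<bind> (\<lambda>e. return_pmf (nat (u mod int n), nat ((u + e) mod int n)))"
      unfolding step_pmf_def bind_assoc_pmf nb[OF u] using u
      by (intro bind_pmf_cong refl) (auto simp: bind_return_pmf bind_map_pmf)
  qed
  then show ?thesis
    by (simp add: map_pmf_def pair_pmf_def bind_assoc_pmf bind_return_pmf)
qed

lemma sym_win_prob_eq_agreement:
  assumes n: "n \<ge> 3"
  shows "sym_win_prob n t A B = agreement n t (unroll n t A) (unroll n t B) step_pmf"
proof -
  let ?U = "pmf_of_set {0..<int n}"
  let ?S = "Pi_pmf {..<t} (0::int) (\<lambda>_. step_pmf)"
  let ?g = "\<lambda>(u, e). (nat (u mod int n), nat ((u + e) mod int n))"
  define W where "W = (\<lambda>cs. \<forall>i<t. cycle_accepts (cs ! i) (A (map fst cs) ! i) (B (map snd cs) ! i))"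
  have fin: "finite (set_pmf (torus n t))" "finite (set_pmf ?S)"
    using n by (auto intro!: finite_set_torus finite_set_Pi_pmf finite_set_step_pmf)
  have "replicate_pmf t (cycle_challenge n) = map_pmf (\<lambda>f. map f [0..<t])
      (map_pmf ((\<circ>) ?g) (map_pmf (\<lambda>(f, g) x. (f x, g x)) (pair_pmf (torus n t) ?S)))"
    unfolding cycle_challenge_eq[OF n] torus_def
    by (subst replicate_pmf_eq_map_Pi_pmf[where d = "(0, 0)"], subst Pi_pmf_map[where dflt = "(0, 0)"],
        simp, simp, subst Pi_pmf_pair) auto
  then have "sym_win_prob n t A B = expect (pair_pmf (torus n t) ?S)
      (\<lambda>z. of_bool (W (map (\<lambda>i. ?g (fst z i, snd z i)) [0..<t])))"
    unfolding sym_win_prob_def W_def[symmetric] prob_eq_expect by (simp add: case_prod_unfold o_def)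
  also have "\<dots> = expect (pair_pmf (torus n t) ?S) (\<lambda>z. of_bool (agree t (unroll n t A) (unroll n t B) (fst z) (snd z)))"
  proof (rule expect_cong)
    fix z assume "z \<in> set_pmf (pair_pmf (torus n t) ?S)"
    moreover obtain X D where z: "z = (X, D)" by force
    ultimately have D: "D \<in> set_pmf ?S" by simp
    have D: "D i \<in> {0, 1, -1}" for i
    proof (cases "i < t")
      case True
      then have "D i \<in> set_pmf step_pmf"
        using D by (subst (asm) set_Pi_pmf) (auto simp: PiE_dflt_def)
      then show ?thesis by (auto simp: set_pmf_eq pmf_step_pmf split: if_splits)
    next
      case False
      then show ?thesis using D set_Pi_pmf_subset[of "{..<t}" 0 "\<lambda>_. step_pmf"] by auto
    qed
    \<comment> \<open>A step in \<open>{0, 1, -1}\<close> is divisible by \<open>n \<ge> 3\<close>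
      only if it is 0, that is, even.\<close>
    have eq: "nat (X i mod int n) = nat ((X i + D i) mod int n) \<longleftrightarrow> even (D i)" for i
    proof -
      have "(X i mod int n = (X i + D i) mod int n) = (int n dvd D i)"
        by (simp add: mod_eq_dvd_iff)
      also have "\<dots> = even (D i)"
        using D[of i] n by (auto dest: zdvd_imp_le)
      finally show ?thesis using n by (simp add: eq_nat_nat_iff)
    qed
    have "W (map (\<lambda>i. ?g (X i, D i)) [0..<t]) = agree t (unroll n t A) (unroll n t B) X D"
      unfolding W_def agree_def
    proof (intro arg_cong[of _ _ All] ext imp_cong refl)
      fix i assume "i < t"
      then show "cycle_accepts (map (\<lambda>i. ?g (X i, D i)) [0..<t] ! i)
          (A (map fst (map (\<lambda>i. ?g (X i, D i)) [0..<t])) ! i) (B (map snd (map (\<lambda>i. ?g (X i, D i)) [0..<t])) ! i)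
        = ((unroll n t A X i \<noteq> unroll n t B (\<lambda>i. X i + D i) i) = odd (D i))"
        by (auto simp: cycle_accepts_def unroll_def position_list_def o_def eq)
    qed
    then show "of_bool (W (map (\<lambda>i. ?g (fst z i, snd z i)) [0..<t])) =
        (of_bool (agree t (unroll n t A) (unroll n t B) (fst z) (snd z)) :: real)"
      by (simp add: z)
  qed
  also have "\<dots> = agreement n t (unroll n t A) (unroll n t B) step_pmf"
    unfolding agreement_def by (subst expect_pair[OF fin]) (simp add: expect_swap[OF fin])
  finally show ?thesis .
qed

section \<open>Comparison of the bounds\<close>

text \<open>A path of \<open>2 n\<close> steps loses at least 1/6 in total. This settles bounded
  \<open>t\<close>.\<close>

lemma loss_ge_cycle:
  assumes n: "odd n" "n \<ge> 3" and t: "t > 0"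
  shows "1 / (12 * real n) \<le> 1 - sym_win_prob n t A B"
proof -
  have "1 - real (2 * n) * (1 - sym_win_prob n t A B) \<le> 5 / 6"
    unfolding sym_win_prob_eq_agreement[OF n(2)]
    using n by (intro order_trans[OF agreement_jump_ge agreement_jump_2n_le]) (auto intro: periodic_unroll t)
  then show ?thesis using n(2) by (simp add: field_simps)
qed

text \<open>The factor 12 keeps displacements within an arc of length \<open>3 * l\<close> in the
  range \<open>T sqrt (2 ^ r) / 4\<close> of \<open>spread_pmf_ge\<close>.\<close>

lemma win_power_le:
  assumes n: "odd n" "n \<ge> 3" and A: "A \<in> sym_strategies n t"
    and T: "even T" "T > 0" "real T * (1 - sym_win_prob n t A B) \<le> 1"
    and l: "l > 0" "2 * l \<le> n" "12 * real l \<le> real T * sqrt (2 ^ r)"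
  shows "(1 - real T * (1 - sym_win_prob n t A B)) ^ (2 ^ r) \<le>
    real n / real l * 4 ^ s * (1 - real l / (2 * real n)) ^ t
    + (1 - (3 * real l / (200 * (real T * sqrt (2 ^ r))))\<^sup>2 / 2) ^ s"
proof -
  let ?a = "unroll n t A"
  let ?k0 = "1 / (200 * (real T * sqrt (2 ^ r)))"
  have n0: "n > 0" using n by simp
  have TQ: "0 < real T * sqrt (2 ^ r)" using T(2) by simp
  have "(1 - real T * (1 - sym_win_prob n t A B)) ^ (2 ^ r) \<le> agreement n t ?a ?a (jump_pmf T) ^ (2 ^ r)"
    unfolding sym_win_prob_eq_agreement[OF n(2)]
    using T(3) unfolding sym_win_prob_eq_agreement[OF n(2)]
    by (intro power_mono agreement_jump_ge[OF n0 periodic_unroll periodic_unroll T(1)]) auto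
  also have "\<dots> \<le> agreement n t ?a ?a (spread_pmf T r)"
    by (rule agreement_spread_ge[OF n0 periodic_unroll])
  also have "\<dots> \<le> real n / real l * 4 ^ s * (1 - real l / (2 * real n)) ^ t
    + (1 - (?k0 * real (3 * l))\<^sup>2 / 2) ^ s"
  proof (rule agreement_le[OF n(1) periodic_unroll equivariant_unroll[OF n0 A] l(1,2) spread_pmf_invariants(1)])
    fix d assume "\<bar>d\<bar> < int (3 * l)"
    then have "\<bar>real_of_int d\<bar> \<le> 3 * real l" by linarith
    also have "\<dots> \<le> real T * sqrt (2 ^ r) / 4" using l(3) by simp
    finally show "?k0 \<le> pmf (spread_pmf T r) d" by (rule spread_pmf_ge[OF T(2)])
  next
    show "?k0 * real (3 * l) \<le> 1" using l(3) TQ by (simp add: field_simps)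
  qed (use TQ in simp)
  finally show ?thesis by (simp add: mult.commute)
qed

lemma one_minus_ge_exp:
  assumes "0 \<le> x" "x \<le> (1 / 2 :: real)"
  shows "exp (- 2 * x) \<le> 1 - x"
proof -
  have "1 \<le> (1 + 2 * x) * (1 - x)" using assms mult_right_mono[of x "1/2" x] by (simp add: algebra_simps)
  also have "\<dots> \<le> exp (2 * x) * (1 - x)" using assms exp_ge_add_one_self[of "2 * x"] by (intro mult_right_mono) auto
  finally show ?thesis by (simp add: exp_minus field_simps)
qed

lemma one_minus_power_le_exp:
  assumes "0 \<le> x" "x \<le> (1 :: real)"
  shows "(1 - x) ^ m \<le> exp (- (x * real m))"
proof -
  have "(1 - x) ^ m \<le> exp (- x) ^ m" using assms exp_ge_add_one_self[of "- x"] by (intro power_mono) auto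
  then show ?thesis by (simp add: exp_of_nat_mult[symmetric] mult.commute)
qed

lemma ex_power2_between:
  assumes "1 \<le> (x::real)"
  obtains r where "x \<le> 2 ^ r" "2 ^ r \<le> 2 * x"
proof -
  define r where "r = (LEAST r. x \<le> 2 ^ r)"
  have ex: "\<exists>r. x \<le> 2 ^ r" using real_arch_pow[of 2 x] by (auto intro: less_imp_le)
  then have r: "x \<le> 2 ^ r" unfolding r_def by (rule LeastI_ex)
  have "2 ^ r \<le> 2 * x"
  proof (cases r)
    case (Suc q)
    then have "\<not> x \<le> 2 ^ q" using not_less_Least[of q "\<lambda>r. x \<le> 2 ^ r"] r_def by auto
    then show ?thesis using Suc by simp
  qed (use assms in simp)
  with r show ?thesis by (rule that)
qed

text \<open>
  Cells hold at least \<open>ln t / 2\<close> points of either label, and each pair of them loses the fraction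
  \<open>\<kappa>\<^sup>2 / 2\<close> for \<open>\<kappa> = 3 l / (200 T sqrt K) \<ge> 1 / 1600\<close>. The rate is the resulting exponent \<open>\<kappa>\<^sup>2 / 4\<close>.
\<close>
definition decay :: real where "decay = 1 / 10240000"

text \<open>
  The jump length \<open>T\<close> is of order \<open>n sqrt (ln t) / t\<close> and there are about \<open>ln t\<close> jumps, so that the
  spread reaches the length \<open>n ln t / t\<close> of cells holding about \<open>ln t\<close> points.
\<close>
lemma loss_ge_large:
  assumes n: "odd n" "n \<ge> 3" and A: "A \<in> sym_strategies n t"
    and t: "2 / decay \<le> ln (real t)" "real t \<le> real n * sqrt (ln (real t))"
  shows "decay / 3104 * (real t / (real n * sqrt (ln (real t)))) \<le> 1 - sym_win_prob n t A B"
proof (rule ccontr)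
  define p where "p = 1 - sym_win_prob n t A B"
  define L where "L = ln (real t)"
  define N where "N = real n"
  define t' where "t' = real t"
  assume "\<not> ?thesis"
  then have p: "p < decay / 3104 * (t' / (N * sqrt L))" by (simp add: p_def L_def N_def t'_def)
  have p0: "0 \<le> p" unfolding p_def sym_win_prob_def by simp
  have L: "20480000 \<le> L" using t(1) by (simp add: decay_def L_def)
  have tpos: "t > 0" using L by (cases "t = 0") (auto simp: L_def)
  have N0: "0 < N" and t0: "0 < t'" using n tpos by (auto simp: N_def t'_def)
  have expL: "exp L = t'" using tpos by (simp add: L_def t'_def)
  obtain r where r: "L \<le> 2 ^ r" "2 ^ r \<le> 2 * L" using ex_power2_between[of L] L by auto
  define K where "K = (2 ^ r :: real)"
  define Q where "Q = sqrt K"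
  have K: "L \<le> K" "K \<le> 2 * L" using r by (auto simp: K_def)
  have Q: "0 < Q" "Q * Q = K" "1 \<le> Q" using K L by (auto simp: Q_def)
  have Q2: "Q \<le> 2 * sqrt L"
  proof -
    have "Q \<le> sqrt (4 * L)" unfolding Q_def using K L by (intro real_sqrt_le_mono) auto
    then show ?thesis by (simp add: real_sqrt_mult)
  qed
  \<comment> \<open>The scale of \<open>T\<close>. The upper bound on \<open>t\<close> makes it at
    least 1, so rounding to an even integer costs only a constant factor.\<close>
  define y where "y = N * Q / t'"
  have y: "1 \<le> y"
  proof -
    have "t' \<le> N * sqrt L" using t(2) by (simp add: t'_def N_def L_def)
    also have "\<dots> \<le> N * Q" unfolding Q_def using K N0 by (intro mult_left_mono real_sqrt_le_mono) auto
    finally show ?thesis using t0 by (simp add: y_def field_simps)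
  qed
  \<comment> \<open>With \<open>l \<ge> T Q / 24\<close> the factor 192 = 8 * 24 yields
    \<open>l \<ge> 8 y Q\<close>, hence at least \<open>8 K\<close> points per cell on
    average.\<close>
  define T where "T = 2 * nat \<lceil>96 * y\<rceil>"
  have T: "192 * y \<le> real T" "real T \<le> 194 * y"
  proof -
    have "96 * y \<le> real (nat \<lceil>96 * y\<rceil>)" "real (nat \<lceil>96 * y\<rceil>) \<le> 96 * y + 1" using y by linarith+
    then show "192 * y \<le> real T" "real T \<le> 194 * y" using y unfolding T_def of_nat_mult of_nat_numeral by linarith+
  qed
  have T0: "T > 0" using T(1) y by (cases T) auto
  define l where "l = nat \<lfloor>real T * Q / 12\<rfloor>"
  have yQ: "1 \<le> y * Q" using mult_mono[OF y Q(3)] y by simp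
  have TQ: "192 * (y * Q) \<le> real T * Q" "real T * Q \<le> 194 * (y * Q)"
    using mult_right_mono[OF T(1), of Q] mult_right_mono[OF T(2), of Q] Q by simp_all
  have l: "real T * Q / 24 \<le> real l" "real l \<le> real T * Q / 12"
    using TQ(1) yQ unfolding l_def by linarith+
  have l8: "8 * (y * Q) \<le> real l" using l(1) TQ(1) by linarith
  then have "0 < real l" using yQ by linarith
  then have l0: "l > 0" by simp
  have yQ': "y * Q = N * K / t'" using Q(2) by (simp add: y_def)
  \<comment> \<open>This makes \<open>l\<close> at most \<open>n / 2\<close>, so that there are two
    cells.\<close>
  have big: "64 * K \<le> t'"
  proof -
    have "128 * L \<le> L * L / 2" using L mult_right_mono[of 256 L L] by simp
    also have "\<dots> \<le> exp L" using exp_lower_Taylor_quadratic[of L] L by (simp add: power2_eq_square)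
    finally show ?thesis using K expL by simp
  qed
  have ln2: "2 * real l \<le> N"
  proof -
    have "2 * real l \<le> 64 * (y * Q)" using l(2) TQ(2) yQ by linarith
    also have "\<dots> = N * (64 * K) / t'" by (simp add: yQ')
    also have "\<dots> \<le> N * t' / t'" using big N0 t0 by (intro divide_right_mono mult_left_mono) auto
    finally show ?thesis using t0 by simp
  qed
  define \<mu> where "\<mu> = real l * t' / N"
  have \<mu>: "8 * K \<le> \<mu>"
  proof -
    have "8 * (N * K / t') * t' / N \<le> \<mu>"
      unfolding \<mu>_def using l8 t0 N0 yQ' by (intro divide_right_mono mult_right_mono) auto
    then show ?thesis using t0 N0 by simp
  qed
  \<comment> \<open>With \<open>\<mu>\<close> the mean number of points per cell,
    \<open>4 ^ s \<le> exp (\<mu> / 4)\<close> is beaten by the factor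
    \<open>exp (- \<mu> / 2)\<close> for sparse cells.\<close>
  define s where "s = nat \<lfloor>\<mu> / 8\<rfloor>"
  have \<mu>0: "0 \<le> \<mu>" using \<mu> K L by simp
  have s: "real s \<le> \<mu> / 8" "\<mu> / 8 - 1 \<le> real s"
    using \<mu>0 unfolding s_def by linarith+
  have s': "L / 2 \<le> real s" using s(2) \<mu> K L by linarith
  \<comment> \<open>3104 = 16 * 194, where 194 comes from the upper bound on
    \<open>T\<close>.\<close>
  have Tp: "real T * p \<le> decay / 8"
  proof -
    have "real T * p \<le> (194 * y) * (decay / 3104 * (t' / (N * sqrt L)))"
      using T p p0 y by (intro mult_mono) auto
    also have "\<dots> = decay / 16 * (Q / sqrt L)"
      using N0 t0 by (simp add: y_def)
    also have "\<dots> \<le> decay / 16 * 2"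
      using Q2 L by (intro mult_left_mono) (auto simp: decay_def field_simps)
    finally show ?thesis by simp
  qed
  have Tp0: "0 \<le> real T * p" using p0 by simp
  have lower: "exp (- (decay * L / 2)) \<le> (1 - real T * p) ^ (2 ^ r)"
  proof -
    have "decay * K \<le> decay * (2 * L)" using K by (intro mult_left_mono) (auto simp: decay_def)
    moreover have "K * (2 * (real T * p)) \<le> K * (decay / 4)" using Tp K L by (intro mult_left_mono) auto
    ultimately have "- (decay * L / 2) \<le> K * (- 2 * (real T * p))" by (simp add: algebra_simps)
    then have "exp (- (decay * L / 2)) \<le> exp (K * (- 2 * (real T * p)))" by simp
    also have "\<dots> = exp (- 2 * (real T * p)) ^ (2 ^ r)"
      using exp_of_nat_mult[of "2 ^ r" "- 2 * (real T * p)"] by (simp add: K_def)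
    also have "\<dots> \<le> (1 - real T * p) ^ (2 ^ r)"
      using Tp Tp0 by (intro power_mono one_minus_ge_exp) (auto simp: decay_def)
    finally show ?thesis .
  qed
  have upper: "(1 - real T * p) ^ (2 ^ r) \<le> N / real l * 4 ^ s * (1 - real l / (2 * N)) ^ t
    + (1 - (3 * real l / (200 * (real T * Q)))\<^sup>2 / 2) ^ s"
    unfolding p_def N_def Q_def K_def
  proof (rule win_power_le[OF n A _ T0 _ l0])
    show "even T" by (simp add: T_def)
    show "real T * (1 - sym_win_prob n t A B) \<le> 1" using Tp by (simp add: p_def decay_def)
    show "2 * l \<le> n" using ln2 by (simp add: N_def)
    show "12 * real l \<le> real T * sqrt (2 ^ r)" using l(2) by (simp add: Q_def K_def)
  qed
  have first: "N / real l * 4 ^ s * (1 - real l / (2 * N)) ^ t \<le> exp (- (decay * L))"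
  proof -
    have "(1 - real l / (2 * N)) ^ t \<le> exp (- (\<mu> / 2))"
      using one_minus_power_le_exp[of "real l / (2 * N)" t] ln2 N0 by (simp add: \<mu>_def t'_def mult.commute)
    moreover have "(4::real) ^ s \<le> exp (\<mu> / 4)"
    proof -
      have "(2::real) \<le> exp 1" using exp_ge_add_one_self[of 1] by simp
      then have "(2::real) ^ (2 * s) \<le> exp 1 ^ (2 * s)" by (intro power_mono) auto
      also have "\<dots> = exp (2 * real s)" by (simp add: exp_of_nat_mult[symmetric])
      also have "\<dots> \<le> exp (\<mu> / 4)" using s(1) by simp
      finally show ?thesis by (simp add: power_mult)
    qed
    moreover have "N / real l \<le> exp L"
    proof -
      have "N / t' \<le> y * Q" using yQ' K L N0 t0 by (simp add: divide_right_mono)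
      then have "N / t' \<le> real l" using l8 yQ by linarith
      then show ?thesis using l0 t0 expL by (simp add: field_simps)
    qed
    ultimately have "N / real l * 4 ^ s * (1 - real l / (2 * N)) ^ t \<le> exp L * exp (\<mu> / 4) * exp (- (\<mu> / 2))"
      using ln2 N0 by (intro mult_mono) (auto simp: field_simps)
    also have "\<dots> = exp (L - \<mu> / 4)" by (simp add: exp_add[symmetric])
    also have "\<dots> \<le> exp (- (decay * L))" using \<mu> K L by (simp add: decay_def)
    finally show ?thesis .
  qed
  have second: "(1 - (3 * real l / (200 * (real T * Q)))\<^sup>2 / 2) ^ s \<le> exp (- (decay * L))"
  proof -
    define \<kappa> where "\<kappa> = 3 * real l / (200 * (real T * Q))"
    have TQ0: "0 < real T * Q" using T0 Q by simp
    have \<kappa>: "1 / 1600 \<le> \<kappa>" "\<kappa> \<le> 1"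
      using l TQ0 unfolding \<kappa>_def by (auto simp: field_simps)
    have "(1 / 1600)\<^sup>2 \<le> \<kappa>\<^sup>2" using \<kappa> by (intro power_mono) auto
    then have \<kappa>2: "2 * decay \<le> \<kappa>\<^sup>2 / 2" by (simp add: decay_def power2_eq_square)
    have "\<kappa>\<^sup>2 \<le> 1" using \<kappa> by (intro power_le_one) auto
    then have "(1 - \<kappa>\<^sup>2 / 2) ^ s \<le> exp (- (\<kappa>\<^sup>2 / 2 * real s))"
      by (intro one_minus_power_le_exp) auto
    also have "2 * decay * (L / 2) \<le> \<kappa>\<^sup>2 / 2 * real s"
      using \<kappa>2 s' L by (intro mult_mono) (auto simp: decay_def)
    then have "exp (- (\<kappa>\<^sup>2 / 2 * real s)) \<le> exp (- (decay * L))" by simp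
    finally show ?thesis by (simp add: \<kappa>_def)
  qed
  \<comment> \<open>Survival is at least \<open>t\<close> to the power \<open>- decay / 2\<close>
    and at most twice \<open>t\<close> to the power \<open>- decay\<close>;
    \<open>decay * L \<ge> 2\<close> makes this impossible.\<close>
  have "exp (- (decay * L / 2)) \<le> 2 * exp (- (decay * L))"
    using lower upper first second by linarith
  also have "\<dots> = exp (- (decay * L / 2)) * (2 * exp (- (decay * L / 2)))" by (simp add: exp_add[symmetric])
  finally have "1 \<le> 2 * exp (- (decay * L / 2))" by simp
  also have "\<dots> \<le> 2 * exp (- 1)" using L by (simp add: decay_def)
  also have "\<dots> < 1" using exp_lower_Taylor_quadratic[of 1] by (simp add: exp_minus field_simps)
  finally show False by simp
qed

theorem theorem1p5:
  shows "\<exists>c::real. c > 0 \<and>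
    (\<forall>n t :: nat. odd n \<longrightarrow> t > 0 \<longrightarrow> real t \<le> c * real n * sqrt (ln (real n)) \<longrightarrow>
       sym_val n t \<le> 1 - c * (real t / (real n * sqrt (ln (real t)))))"
proof -
  \<comment> \<open>The second entry serves \<open>2 \<le> t < exp (2 / decay)\<close>: there
    \<open>sqrt (ln t) \<ge> 1/2\<close>, and the loss \<open>1 / (12 n)\<close> suffices because 24
    = 12 * 2.\<close>
  define c where "c = min (decay / 3104) (exp (- (2 / decay)) / 24)"
  have c: "0 < c" "c \<le> decay / 3104" "c \<le> exp (- (2 / decay)) / 24" "c \<le> 1 / 2"
    by (auto simp: c_def decay_def)
  have main: "c * (real t / (real n * sqrt (ln (real t)))) \<le> 1 - sym_win_prob n t A B"
    if n: "odd n" and t: "t > 0" "real t \<le> c * real n * sqrt (ln (real n))"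
      and A: "A \<in> sym_strategies n t" for n t A B
  proof -
    \<comment> \<open>As \<open>ln 1 = 0\<close>, the bound on \<open>t\<close> would force
      \<open>t = 0\<close>.\<close>
    have "n \<noteq> 1" using t by auto
    then have n3: "n \<ge> 3" using n by presburger
    have win: "sym_win_prob n t A B \<le> 1" by (simp add: sym_win_prob_def)
    define L where "L = ln (real t)"
    consider "t = 1" | "t \<ge> 2" "L < 2 / decay" | "2 / decay \<le> L" using t(1) by linarith
    then show ?thesis
    proof cases
      \<comment> \<open>Here \<open>ln t = 0\<close>, and division by zero makes the claimed loss
        0.\<close>
      case 1
      then show ?thesis using win by simp
    next
      case 2
      have "1 / 4 \<le> ln (1 + 1 / 2 :: real)"
        using ln_one_plus_pos_lower_bound[of "1 / 2"] by (simp add: power2_eq_square)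
      also have "\<dots> \<le> ln 2" by simp
      also have "ln 2 \<le> L" unfolding L_def using 2(1) by simp
      finally have "sqrt (1 / 4) \<le> sqrt L" by (rule real_sqrt_le_mono)
      then have "1 / 2 \<le> sqrt L" by (simp add: real_sqrt_divide)
      moreover have "0 \<le> L" using 2(1) by (simp add: L_def)
      ultimately have L: "1 / 2 \<le> sqrt L" "0 \<le> L" by simp_all
      have "real t = exp L" using t(1) by (simp add: L_def)
      then have "real t \<le> exp (2 / decay)" using 2(2) by simp
      then have "c * (real t / (real n * sqrt L)) \<le> exp (- (2 / decay)) / 24 * (exp (2 / decay) / (real n * (1 / 2)))"
        using c L n3 by (intro mult_mono frac_le divide_nonneg_nonneg mult_nonneg_nonneg) auto
      also have "\<dots> = 1 / (12 * real n)" by (simp add: exp_minus)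
      also have "\<dots> \<le> 1 - sym_win_prob n t A B" by (rule loss_ge_cycle[OF n n3 t(1)])
      finally show ?thesis by (simp add: L_def)
    next
      case 3
      then have L1: "1 \<le> L" by (simp add: decay_def)
      \<comment> \<open>This trades \<open>ln n\<close> for \<open>ln t\<close>: they are comparable
        if \<open>n \<le> t^2\<close>, and otherwise \<open>t \<le> n\<close> already.\<close>
      have "real t \<le> real n * sqrt L"
      proof (cases "n \<le> t\<^sup>2")
        case True
        then have "real n \<le> real t ^ 2" by (metis of_nat_le_iff of_nat_power)
        then have "ln (real n) \<le> ln (real t ^ 2)" using n3 by (intro ln_mono) auto
        also have "\<dots> = 2 * L" using t(1) by (simp add: L_def ln_realpow)
        finally have "ln (real n) \<le> 2 * L" .
        then have "sqrt (ln (real n)) \<le> sqrt (4 * L)" using L1 by (intro real_sqrt_le_mono) auto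
        then have "sqrt (ln (real n)) \<le> 2 * sqrt L" by (simp add: real_sqrt_mult)
        then have "c * real n * sqrt (ln (real n)) \<le> (1 / 2) * real n * (2 * sqrt L)"
          using c n3 by (intro mult_mono) auto
        with t(2) show ?thesis by simp
      next
        case False
        then have "t * t \<le> n" by (simp add: power2_eq_square)
        then have "t \<le> n" using t(1) by (metis le_trans le_square)
        then have "real t * 1 \<le> real n * sqrt L" using L1 by (intro mult_mono) auto
        then show ?thesis by simp
      qed
      then have "decay / 3104 * (real t / (real n * sqrt L)) \<le> 1 - sym_win_prob n t A B"
        using 3 unfolding L_def by (intro loss_ge_large[OF n n3 A]) auto
      moreover have "c * (real t / (real n * sqrt L)) \<le> decay / 3104 * (real t / (real n * sqrt L))"
        using c L1 by (intro mult_right_mono) auto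
      ultimately show ?thesis by (simp add: L_def)
    qed
  qed
  have "sym_val n t \<le> 1 - c * (real t / (real n * sqrt (ln (real t))))"
    if "odd n" "t > 0" "real t \<le> c * real n * sqrt (ln (real n))" for n t
    unfolding sym_val_def
  proof (rule Max.boundedI[OF finite_sym_win_probs])
    show "{sym_win_prob n t A B |A B. A \<in> sym_strategies n t \<and> B \<in> sym_strategies n t} \<noteq> {}"
      using sym_strategies_nonempty by blast
    show "x \<le> 1 - c * (real t / (real n * sqrt (ln (real t))))"
      if "x \<in> {sym_win_prob n t A B |A B. A \<in> sym_strategies n t \<and> B \<in> sym_strategies n t}" for x
    proof -
      from that obtain A B where "x = sym_win_prob n t A B" "A \<in> sym_strategies n t" by blast
      with main[OF \<open>odd n\<close> \<open>t > 0\<close> \<open>real t \<le> _\<close>, of A B] show ?thesis by simp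
    qed
  qed
  with c(1) show ?thesis by blast
qed

end
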